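(* Assume $c_R\ge c_S$. Let the aggregation function be $\min$ (with $m$ arguments). Let $\mathbf{D}$ be the class of all databases (with $m$ sorted lists) that satisfy the distinctness property. Let $\mathbf{A}$ be the class of all algorithms that correctly find the top $k$ objects for $\min$ for every database in $\mathbf{D}$. Then the algorithm CA is instance optimal over $\mathbf{A}$ and $\mathbf{D}$, with optimality ratio independent of $c_R/c_S$ (that is, the optimality ratio can be chosen as a constant that stays the same when $c_R$ and $c_S$ vary).
   Context: Setting: fix positive integers $m$ and $k$ (treated as constants). A database consists of a finite set of $N\ge k$ objects; each object $R$ has $m$ grades (fields) $x_1,\dots,x_m\in[0,1]$. It is presented as $m$ sorted lists $L_1,\dots,L_m$ of length $N$; list $L_i$ contains one entry $(R,x_i)$ for each object $R$, in descending order of $x_i$. A database satisfies the distinctness property if for each $i$ no two objects have the same grade in list $L_i$. The overall grade of $R$ under the aggregation function $t=\min$ is $t(R)=\min(x_1,\dots,x_m)$. Finding the top $k$ objects means outputting $k$ objects with the highest overall grades (ties broken arbitrarily), without necessarily giving their grades. Access and cost: an algorithm obtains information about the database only by sorted access (reading the next entry of some list, proceeding sequentially from the top) and random access (requesting the grade of a given object in a given list, obtained in one step; the object may be one not previously seen). Internal computation is free. With $s$ sorted and $r$ random accesses the middleware cost is $s c_S+r c_R$, where $c_S,c_R>0$; $cost(\mathcal A,\mathcal D)$ is the middleware cost of algorithm $\mathcal A$ on database $\mathcal D$. Instance optimality: algorithm $\mathcal B$ is instance optimal over $\mathbf A$ and $\mathbf D$ with optimality ratio $c$ if $\mathcal B\in\mathbf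 A$ and there is a constant $c'$ such that $cost(\mathcal B,\mathcal D)\le c\cdot cost(\mathcal A,\mathcal D)+c'$ for every $\mathcal A\in\mathbf A$ and $\mathcal D\in\mathbf D$. (The additive constant $c'$ may depend on $c_S,c_R$.) Bounds: for an object $R$ with set $S\subseteq\{1,\dots,m\}$ of known fields, $W_S(R)$ is the value of $t$ obtained by using the known values for the fields in $S$ and $0$ for every other field; $B_S(R)$ is the value of $t$ obtained by using the known values for the fields in $S$ and $\underline{x}_i$ for every field $i\notin S$, where $\underline{x}_i$ (the bottom value) is the last value obtained under sorted access in $L_i$. Algorithm CA, with $h=\lfloor c_R/c_S\rfloor$: (1) Do sorted access in parallel to each of the lists. At each depth $d$ (when $d$ entries have been read in each list): maintain the bottom values $\underline{x}_i^{(d)}$; for every object $R$ with discovered fields $S=S^{(d)}(R)$ (discovered by sorted or random access) let $W^{(d)}(R)=W_S(R)$ and $B^{(d)}(R)=B_S(R)$ (for unseen $R$, $S=\emptyset$). Let $T_k^{(d)}$ contain the $k$ objects seen so far with the largest $W^{(d)}$ values, ties being broken in favor of the larger $B^{(d)}$ value (and arbitrarily if these also tie). Let $M_k^{(d)}$ be the $k$th largest $W^{(d)}$ value in $T_k^{(d)}$. (2) Call $R$ viable if $B^{(d)}(R)>M_k^{(d)}$ (convention: while fewer than $k$ objects have been seen, every object counts as viable). Every time the depth increases by $h$: pick the viable object that has been seen, for which not all fields are known, and whose $B^{(d)}$ value is as big as possible (ties broken arbitrarily), and perform random accesses for all of its (at most $m-1$) missing fields, updating the bounds accordingly; if there is no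 such object, do no random access on this step. (3) Halt when (a) at least $k$ distinct objects have been seen and (b) $B^{(d)}(R)\le M_k^{(d)}$ for all objects $R\notin T_k^{(d)}$. Return the objects in $T_k^{(d)}$. *)

theory Defs
  imports Complex_Main
begin

section \<open>Databases\<close>

text \<open>Fields and lists are indexed by \<open>0, \<dots>, m - 1\<close>. The list \<open>L\<^sub>i\<close> consists of the entries
  \<open>(R, grade D R i)\<close> for \<open>R\<close> running through \<open>sorted_list D i\<close>.\<close>

record 'a database =
  objects :: "'a set"
  grade :: "'a \<Rightarrow> nat \<Rightarrow> real"
  sorted_list :: "nat \<Rightarrow> 'a list"

definition databases :: "nat \<Rightarrow> nat \<Rightarrow> 'a database set" where
  "databases m k = {D. finite (objects D) \<and> k \<le> card (objects D) \<and>
     (\<forall>R\<in>objects D. \<forall>i<m. 0 \<le> grade D R i \<and> grade D R i \<le> 1) \<and>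
     (\<forall>i<m. distinct (sorted_list D i) \<and> set (sorted_list D i) = objects D \<and>
        sorted_wrt (\<lambda>R R'. grade D R i \<ge> grade D R' i) (sorted_list D i))}"

definition distinctness :: "nat \<Rightarrow> 'a database \<Rightarrow> bool" where
  "distinctness m D \<longleftrightarrow> (\<forall>i<m. inj_on (\<lambda>R. grade D R i) (objects D))"

definition distinct_databases :: "nat \<Rightarrow> nat \<Rightarrow> 'a database set" where
  "distinct_databases m k = {D \<in> databases m k. distinctness m D}"

definition agg_min :: "nat \<Rightarrow> (nat \<Rightarrow> real) \<Rightarrow> real" where
  "agg_min m x = Min (x ` {..<m})"

definition overall :: "nat \<Rightarrow> 'a database \<Rightarrow> 'a \<Rightarrow> real" where
  "overall m D R = agg_min m (grade D R)"

definition is_top_answer :: "nat \<Rightarrow> nat \<Rightarrow> 'a database \<Rightarrow> 'a set \<Rightarrow> bool" where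
  "is_top_answer m k D Y \<longleftrightarrow> Y \<subseteq> objects D \<and> card Y = k \<and>
     (\<forall>R\<in>Y. \<forall>R'\<in>objects D - Y. overall m D R' \<le> overall m D R)"


section \<open>Algorithms and their cost\<close>

text \<open>An algorithm is a deterministic strategy: it chooses its next move from the accesses made so
  far and their results, and from nothing else. In particular it is told neither the number nor the
  names of the objects of the database. The result \<open>None\<close> of an access means that the list is
  exhausted, that the object asked for is not in the database, or that the list does not exist.\<close>

datatype 'a event =
    SortedEv nat "('a \<times> real) option"
  | RandomEv 'a nat "real option"

datatype 'a move = Sorted nat | Random 'a nat | Halt "'a set"

type_synonym 'a algorithm = "'a event list \<Rightarrow> 'a move"

fun is_sorted_ev :: "'a event \<Rightarrow> bool" where
  "is_sorted_ev (SortedEv _ _) = True"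
| "is_sorted_ev (RandomEv _ _ _) = False"

fun is_sorted_ev_in :: "nat \<Rightarrow> 'a event \<Rightarrow> bool" where
  "is_sorted_ev_in i (SortedEv j _) = (j = i)"
| "is_sorted_ev_in i (RandomEv _ _ _) = False"

definition sorted_pos :: "'a event list \<Rightarrow> nat \<Rightarrow> nat" where
  "sorted_pos H i = length (filter (is_sorted_ev_in i) H)"

fun perform :: "nat \<Rightarrow> 'a database \<Rightarrow> 'a event list \<Rightarrow> 'a move \<Rightarrow> 'a event list" where
  "perform m D H (Sorted i) = H @ [SortedEv i
     (if i < m \<and> sorted_pos H i < length (sorted_list D i)
      then Some (sorted_list D i ! sorted_pos H i, grade D (sorted_list D i ! sorted_pos H i) i)
      else None)]"
| "perform m D H (Random R i) = H @ [RandomEv R i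
     (if i < m \<and> R \<in> objects D then Some (grade D R i) else None)]"
| "perform m D H (Halt Y) = H"

primrec run :: "nat \<Rightarrow> 'a algorithm \<Rightarrow> 'a database \<Rightarrow> nat \<Rightarrow> 'a event list" where
  "run m A D 0 = []"
| "run m A D (Suc n) = perform m D (run m A D n) (A (run m A D n))"

definition halts :: "nat \<Rightarrow> 'a algorithm \<Rightarrow> 'a database \<Rightarrow> bool" where
  "halts m A D \<longleftrightarrow> (\<exists>n Y. A (run m A D n) = Halt Y)"

definition final_history :: "nat \<Rightarrow> 'a algorithm \<Rightarrow> 'a database \<Rightarrow> 'a event list" where
  "final_history m A D = run m A D (LEAST n. \<exists>Y. A (run m A D n) = Halt Y)"

definition correct_algorithms :: "nat \<Rightarrow> nat \<Rightarrow> 'a database set \<Rightarrow> 'a algorithm set" where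
  "correct_algorithms m k \<D> = {A. \<forall>D\<in>\<D>. halts m A D \<and>
     (\<forall>Y. A (final_history m A D) = Halt Y \<longrightarrow> is_top_answer m k D Y)}"

definition middleware_cost :: "nat \<Rightarrow> real \<Rightarrow> real \<Rightarrow> 'a algorithm \<Rightarrow> 'a database \<Rightarrow> real" where
  "middleware_cost m cS cR A D =
     (let H = final_history m A D in
      real (length (filter is_sorted_ev H)) * cS +
      real (length (filter (\<lambda>e. \<not> is_sorted_ev e) H)) * cR)"

definition instance_optimal ::
    "('alg \<Rightarrow> 'db \<Rightarrow> real) \<Rightarrow> 'alg \<Rightarrow> 'alg set \<Rightarrow> 'db set \<Rightarrow> real \<Rightarrow> bool" where
  "instance_optimal cost \<B> \<A> \<D> c \<longleftrightarrow>
     \<B> \<in> \<A> \<and> (\<exists>c'. \<forall>A\<in>\<A>. \<forall>D\<in>\<D>. cost \<B> D \<le> c * cost A D + c')"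


section \<open>Bounds derived from a history\<close>

definition reveals :: "'a event list \<Rightarrow> 'a \<Rightarrow> nat \<Rightarrow> real \<Rightarrow> bool" where
  "reveals H R i x \<longleftrightarrow> SortedEv i (Some (R, x)) \<in> set H \<or> RandomEv R i (Some x) \<in> set H"

definition fields :: "'a event list \<Rightarrow> 'a \<Rightarrow> nat set" where
  "fields H R = {i. \<exists>x. reveals H R i x}"

definition field_value :: "'a event list \<Rightarrow> 'a \<Rightarrow> nat \<Rightarrow> real" where
  "field_value H R i = (THE x. reveals H R i x)"

definition seen :: "'a event list \<Rightarrow> 'a set" where
  "seen H = {R. fields H R \<noteq> {}}"

text \<open>Before the first sorted access to a list its bottom value is 1, the largest possible grade;
  CA never consults this initial value.\<close>

primrec bottom_from :: "nat \<Rightarrow> real \<Rightarrow> 'a event list \<Rightarrow> real" where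
  "bottom_from i b [] = b"
| "bottom_from i b (e # H) = bottom_from i
     (case e of SortedEv j (Some (R, x)) \<Rightarrow> if j = i then x else b | _ \<Rightarrow> b) H"

definition bottom :: "'a event list \<Rightarrow> nat \<Rightarrow> real" where
  "bottom H i = bottom_from i 1 H"

definition W_bound :: "nat \<Rightarrow> 'a event list \<Rightarrow> 'a \<Rightarrow> real" where
  "W_bound m H R = agg_min m (\<lambda>i. if i \<in> fields H R then field_value H R i else 0)"

definition B_bound :: "nat \<Rightarrow> 'a event list \<Rightarrow> 'a \<Rightarrow> real" where
  "B_bound m H R = agg_min m (\<lambda>i. if i \<in> fields H R then field_value H R i else bottom H i)"


section \<open>Algorithm CA\<close>

text \<open>The admissible choices for \<open>T\<^sub>k\<close>; they differ only in how objects tied in both \<open>W\<close> and \<open>B\<close>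
  are selected.\<close>

definition is_T :: "nat \<Rightarrow> nat \<Rightarrow> 'a event list \<Rightarrow> 'a set \<Rightarrow> bool" where
  "is_T m k H T \<longleftrightarrow> T \<subseteq> seen H \<and> card T = k \<and>
     (\<forall>R\<in>T. \<forall>R'\<in>seen H - T. W_bound m H R' < W_bound m H R \<or>
        (W_bound m H R' = W_bound m H R \<and> B_bound m H R' \<le> B_bound m H R))"

text \<open>\<open>M\<^sub>k\<close> is the least of the \<open>k\<close> values \<open>W\<close> on \<open>T\<^sub>k\<close>; it is the same for all admissible \<open>T\<^sub>k\<close>.
  It is meaningful only once \<open>k\<close> objects have been seen.\<close>

definition M_bound :: "nat \<Rightarrow> nat \<Rightarrow> 'a event list \<Rightarrow> real" where
  "M_bound m k H = (THE M. \<exists>T. is_T m k H T \<and> M = Min (W_bound m H ` T))"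

definition viable :: "nat \<Rightarrow> nat \<Rightarrow> 'a event list \<Rightarrow> 'a \<Rightarrow> bool" where
  "viable m k H R \<longleftrightarrow> card (seen H) < k \<or> B_bound m H R > M_bound m k H"

definition candidates :: "nat \<Rightarrow> nat \<Rightarrow> 'a event list \<Rightarrow> 'a set" where
  "candidates m k H = {R \<in> seen H. viable m k H R \<and> \<not> {..<m} \<subseteq> fields H R}"

definition best_candidates :: "nat \<Rightarrow> nat \<Rightarrow> 'a event list \<Rightarrow> 'a set" where
  "best_candidates m k H =
     {R \<in> candidates m k H. \<forall>R'\<in>candidates m k H. B_bound m H R' \<le> B_bound m H R}"

definition depth :: "nat \<Rightarrow> 'a event list \<Rightarrow> nat" where
  "depth m H = Min (sorted_pos H ` {..<m})"

definition round_complete :: "nat \<Rightarrow> 'a event list \<Rightarrow> bool" where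
  "round_complete m H \<longleftrightarrow> (\<forall>i<m. sorted_pos H i = depth m H)"

text \<open>The random accesses that step (2) may perform next. If the last event is a sorted access, step
  (2) is just starting and picks its object. If it is a random access, the object of that access
  is the one picked at this depth, and only its remaining missing fields are still to be requested.\<close>

definition pending :: "nat \<Rightarrow> nat \<Rightarrow> nat \<Rightarrow> 'a event list \<Rightarrow> 'a move set" where
  "pending m k h H =
     (if 0 < depth m H \<and> h dvd depth m H then
        {Random R i | R i. i < m \<and> i \<notin> fields H R \<and>
           (case last H of SortedEv _ _ \<Rightarrow> R \<in> best_candidates m k H | RandomEv R' _ _ \<Rightarrow> R = R')}
      else {})"

text \<open>Condition (b) ranges over all objects an algorithm may encounter, so as long as there may be an
  unseen object it entails that the minimum of the bottom values is at most \<open>M\<^sub>k\<close>.\<close>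

definition halting_moves :: "nat \<Rightarrow> nat \<Rightarrow> 'a event list \<Rightarrow> 'a move set" where
  "halting_moves m k H =
     {Halt T | T. k \<le> card (seen H) \<and> is_T m k H T \<and>
        (\<forall>R. R \<notin> T \<longrightarrow> B_bound m H R \<le> M_bound m k H)}"

definition next_sorted :: "nat \<Rightarrow> 'a event list \<Rightarrow> 'a move set" where
  "next_sorted m H = {Sorted i | i. i < m \<and> sorted_pos H i = depth m H}"

definition CA_moves :: "nat \<Rightarrow> nat \<Rightarrow> nat \<Rightarrow> 'a event list \<Rightarrow> 'a move set" where
  "CA_moves m k h H =
     (if \<not> round_complete m H then next_sorted m H
      else if pending m k h H \<noteq> {} then pending m k h H
      else if halting_moves m k H \<noteq> {} then halting_moves m k H
      else next_sorted m H)"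

text \<open>A tie breaker resolves everything CA leaves open: the ties in \<open>T\<^sub>k\<close> and in the choice of the
  object for random access, the order in which its missing fields are requested, and the order of
  the lists within one round of parallel sorted access.\<close>

definition tie_breaker :: "('a event list \<Rightarrow> 'a move set \<Rightarrow> 'a move) \<Rightarrow> bool" where
  "tie_breaker tb \<longleftrightarrow> (\<forall>H X. X \<noteq> {} \<longrightarrow> tb H X \<in> X)"

definition CA ::
    "nat \<Rightarrow> nat \<Rightarrow> nat \<Rightarrow> ('a event list \<Rightarrow> 'a move set \<Rightarrow> 'a move) \<Rightarrow> 'a algorithm" where
  "CA m k h tb H = tb H (CA_moves m k h H)"

end

theory Submission
  imports Defs
begin

text \<open>Let a correct algorithm \<open>A\<close> read at most \<open>d\<close> entries of each list and make \<open>r\<close> random accesses,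
  and let \<open>\<tau>\<close> be the least overall grade in its output \<open>Y\<close>. If \<open>A\<close> stops before any list is
  exhausted, an adversary argument shows that with the knowledge of \<open>A\<close> no object outside \<open>Y\<close>, not
  even an object absent from the database, has a \<open>B\<close> value above \<open>\<tau>\<close>. Now consider a random access
  step of CA at depth at least \<open>d\<close> at which no bottom value equals \<open>\<tau>\<close>; by distinctness this excludes
  at most \<open>m\<close> depths. If there is no candidate, CA halts. Otherwise the object picked belongs to \<open>Y\<close>, or
  has a grade equal to \<open>\<tau>\<close> (at most \<open>m\<close> objects do), or was accessed at random by \<open>A\<close>. As no object is
  picked twice, CA enters at most \<open>r + k + 2 m + 1\<close> steps at depth at least \<open>d\<close>, and each of them
  together with the \<open>h\<close> rounds following it costs at most \<open>2 m c\<^sub>R\<close>. The steps before depth \<open>d\<close> are paid for by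
  the sorted accesses of \<open>A\<close>, since \<open>c\<^sub>R \<le> 2 h c\<^sub>S\<close>. The ratio is \<open>3 m\<close>. Over a finite type of objects the cost of CA
  is bounded, so the additive constant suffices.\<close>

section \<open>Minima, histories and runs\<close>

lemma agg_min_le: "i < m \<Longrightarrow> agg_min m x \<le> x i"
  by (auto simp: agg_min_def intro!: Min_le)

lemma agg_min_ge_iff: "0 < m \<Longrightarrow> y \<le> agg_min m x \<longleftrightarrow> (\<forall>i<m. y \<le> x i)"
  unfolding agg_min_def by (subst Min_ge_iff) auto

lemma agg_min_attained: "0 < m \<Longrightarrow> \<exists>i<m. agg_min m x = x i"
  using Min_in[of "x ` {..<m}"] unfolding agg_min_def by fastforce

lemma agg_min_mono: "0 < m \<Longrightarrow> (\<And>i. i < m \<Longrightarrow> x i \<le> y i) \<Longrightarrow> agg_min m x \<le> agg_min m y"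
  by (meson agg_min_ge_iff agg_min_le order_trans)

lemma agg_min_cong: "(\<And>i. i < m \<Longrightarrow> x i = y i) \<Longrightarrow> agg_min m x = agg_min m y"
  unfolding agg_min_def by (metis (no_types, lifting) image_cong lessThan_iff)

text \<open>Histories of arbitrary move sequences, so that facts about the knowledge gained apply to
  the competitor and to CA alike.\<close>

inductive history :: "nat \<Rightarrow> 'a database \<Rightarrow> 'a event list \<Rightarrow> bool" for m D where
  Nil: "history m D []"
| perform: "history m D H \<Longrightarrow> history m D (perform m D H a)"

lemma history_run: "history m D (run m A D n)"
  by (induction n) (auto intro: history.intros)

lemma sorted_pos_Nil [simp]: "sorted_pos [] i = 0"
  by (simp add: sorted_pos_def)

lemma sorted_pos_snoc [simp]:
  "sorted_pos (H @ [SortedEv j v]) i = sorted_pos H i + (if i = j then 1 else 0)"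
  "sorted_pos (H @ [RandomEv R j w]) i = sorted_pos H i"
  by (auto simp: sorted_pos_def)

lemma sorted_pos_perform:
  "sorted_pos (perform m D H a) i = sorted_pos H i + (if a = Sorted i then 1 else 0)"
  by (cases a) auto

lemma set_perform_mono: "set H \<subseteq> set (perform m D H a)"
  by (cases a) auto

lemma sorted_pos_le_sorted_count: "sorted_pos H i \<le> length (filter is_sorted_ev H)"
proof (induction H rule: rev_induct)
  case (snoc e H)
  then show ?case by (cases e) auto
qed simp

lemma bottom_snoc [simp]:
  "bottom (H @ [SortedEv j None]) i = bottom H i"
  "bottom (H @ [SortedEv j (Some (R, x))]) i = (if j = i then x else bottom H i)"
  "bottom (H @ [RandomEv R j w]) i = bottom H i"
proof -
  have "bottom_from i b (H @ H') = bottom_from i (bottom_from i b H) H'" for b H'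
    by (induction H arbitrary: b) auto
  then show "bottom (H @ [SortedEv j None]) i = bottom H i"
    "bottom (H @ [SortedEv j (Some (R, x))]) i = (if j = i then x else bottom H i)"
    "bottom (H @ [RandomEv R j w]) i = bottom H i"
    by (auto simp: bottom_def)
qed

lemma final_history_eq:
  assumes "A (run m A D n) = Halt Y" and "\<And>n' Y'. n' < n \<Longrightarrow> A (run m A D n') \<noteq> Halt Y'"
  shows "final_history m A D = run m A D n"
proof -
  have "(LEAST n. \<exists>Y. A (run m A D n) = Halt Y) = n"
    using assms by (intro Least_equality) (auto simp: not_less[symmetric])
  then show ?thesis by (simp add: final_history_def)
qed

lemma halting_run:
  assumes "halts m A D"
  obtains n Y where "A (run m A D n) = Halt Y" "final_history m A D = run m A D n"
    "\<And>n' Y'. n' < n \<Longrightarrow> A (run m A D n') \<noteq> Halt Y'"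
proof -
  let ?n = "LEAST n. \<exists>Y. A (run m A D n) = Halt Y"
  have "\<exists>Y. A (run m A D ?n) = Halt Y"
    using assms unfolding halts_def by (rule LeastI_ex)
  then obtain Y where Y: "A (run m A D ?n) = Halt Y" by blast
  have "A (run m A D n') \<noteq> Halt Y'" if "n' < ?n" for n' Y'
    using not_less_Least[OF that] by blast
  then show thesis using that[OF Y] by (simp add: final_history_def)
qed

section \<open>What a history reveals about a database with distinct grades\<close>

locale ranked_database =
  fixes m k :: nat and D :: "'a database"
  assumes m_pos: "0 < m" and k_pos: "0 < k" and database: "D \<in> distinct_databases m k"
begin

abbreviation "N \<equiv> card (objects D)"

lemma finite_objects: "finite (objects D)"
  and k_le_N: "k \<le> N"
  and grade_nonneg: "R \<in> objects D \<Longrightarrow> i < m \<Longrightarrow> 0 \<le> grade D R i"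
  and grade_le_1: "R \<in> objects D \<Longrightarrow> i < m \<Longrightarrow> grade D R i \<le> 1"
  and distinct_list: "i < m \<Longrightarrow> distinct (sorted_list D i)"
  and set_list: "i < m \<Longrightarrow> set (sorted_list D i) = objects D"
  and sorted_list: "i < m \<Longrightarrow> sorted_wrt (\<lambda>R R'. grade D R i \<ge> grade D R' i) (sorted_list D i)"
  and inj_grade: "i < m \<Longrightarrow> inj_on (\<lambda>R. grade D R i) (objects D)"
  using database by (auto simp: distinct_databases_def databases_def distinctness_def)

lemma length_list: "i < m \<Longrightarrow> length (sorted_list D i) = N"
  using distinct_card[OF distinct_list] set_list by simp

lemma nth_list: "i < m \<Longrightarrow> p < N \<Longrightarrow> sorted_list D i ! p \<in> objects D"
  using length_list set_list nth_mem by metis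

lemma grade_strict:
  assumes "i < m" "p < q" "q < N"
  shows "grade D (sorted_list D i ! q) i < grade D (sorted_list D i ! p) i"
proof -
  have "grade D (sorted_list D i ! q) i \<le> grade D (sorted_list D i ! p) i"
    using sorted_wrt_nth_less[OF sorted_list[OF assms(1)], of p q] assms length_list by simp
  moreover have "sorted_list D i ! q \<noteq> sorted_list D i ! p"
    using assms length_list distinct_list by (simp add: nth_eq_iff_index_eq)
  ultimately show ?thesis
    using inj_onD[OF inj_grade[OF assms(1)], of "sorted_list D i ! q" "sorted_list D i ! p"]
      nth_list assms by fastforce
qed

lemma overall_le: "i < m \<Longrightarrow> overall m D R \<le> grade D R i"
  by (simp add: overall_def agg_min_le)

lemma sorted_event_iff:
  assumes "history m D H"
  shows "SortedEv i (Some (R, x)) \<in> set H \<longleftrightarrow>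
    i < m \<and> R \<in> set (take (sorted_pos H i) (sorted_list D i)) \<and> x = grade D R i"
  using assms
proof induction
  case (perform H a)
  show ?case
  proof (cases "a = Sorted i")
    case True
    then show ?thesis
      using perform.IH by (auto simp: take_Suc_conv_app_nth)
  next
    case False
    then show ?thesis
      using perform.IH by (cases a) auto
  qed
qed simp

lemma random_event_result:
  assumes "history m D H" "RandomEv R i v \<in> set H"
  shows "v = (if i < m \<and> R \<in> objects D then Some (grade D R i) else None)"
  using assms
proof induction
  case (perform H a)
  then show ?case by (cases a) auto
qed simp

text \<open>A random access to an object of the database in an existing list always succeeds, so any
  such event reveals the field.\<close>

lemma fields_iff:
  assumes "history m D H"
  shows "i \<in> fields H R \<longleftrightarrow> i < m \<and> R \<in> objects D \<and>
    (R \<in> set (take (sorted_pos H i) (sorted_list D i)) \<or> (\<exists>v. RandomEv R i v \<in> set H))"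
proof -
  have "(\<exists>x. RandomEv R i (Some x) \<in> set H) \<longleftrightarrow>
      i < m \<and> R \<in> objects D \<and> (\<exists>v. RandomEv R i v \<in> set H)"
    using random_event_result[OF assms, of R i] by (metis option.distinct(1))
  moreover have "(\<exists>x. SortedEv i (Some (R, x)) \<in> set H) \<longleftrightarrow>
      i < m \<and> R \<in> objects D \<and> R \<in> set (take (sorted_pos H i) (sorted_list D i))"
    using sorted_event_iff[OF assms] set_list in_set_takeD by metis
  ultimately show ?thesis
    unfolding fields_def reveals_def by blast
qed

lemma field_value:
  assumes "history m D H" "i \<in> fields H R"
  shows "field_value H R i = grade D R i"
proof -
  obtain x where "reveals H R i x" using assms by (auto simp: fields_def)
  moreover have "reveals H R i y \<Longrightarrow> y = grade D R i" for y
    using sorted_event_iff[OF assms(1), of i R y] random_event_result[OF assms(1), of R i "Some y"]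
    by (auto simp: reveals_def split: if_splits)
  ultimately show ?thesis unfolding field_value_def by blast
qed

lemma fields_perform_mono: "fields H R \<subseteq> fields (perform m D H a) R"
  using set_perform_mono[of H m D a] by (auto simp: fields_def reveals_def)

lemma seen_subset: "history m D H \<Longrightarrow> seen H \<subseteq> objects D"
  using fields_iff by (auto simp: seen_def)

text \<open>Positions count attempted reads; a read past the end returns \<open>None\<close> and
  leaves the bottom value alone, hence the bound by \<open>N\<close>.\<close>

lemma bottom_eq:
  assumes "history m D H" "i < m" "sorted_pos H i \<le> N"
  shows "bottom H i =
    (if sorted_pos H i = 0 then 1 else grade D (sorted_list D i ! (sorted_pos H i - 1)) i)"
  using assms
proof induction
  case Nil
  then show ?case by (simp add: bottom_def)
next
  case (perform H a)
  show ?case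
  proof (cases "a = Sorted i")
    case True
    then show ?thesis
      using perform length_list[OF perform(3)] by auto
  next
    case False
    then have "sorted_pos (perform m D H a) i = sorted_pos H i" "bottom (perform m D H a) i = bottom H i"
      by (cases a; auto)+
    then show ?thesis using perform by simp
  qed
qed

lemma unread_index:
  assumes "i < m" "R \<in> objects D" "R \<notin> set (take p (sorted_list D i))"
  obtains q where "p \<le> q" "q < N" "R = sorted_list D i ! q"
proof -
  obtain q where q: "q < N" "R = sorted_list D i ! q"
    using assms set_list length_list by (metis in_set_conv_nth)
  then have "p \<le> q"
    using assms length_list by (metis in_set_conv_nth length_take min_less_iff_conj not_le nth_take)
  then show thesis using q that by blast
qed

text \<open>Distinctness puts unread entries strictly below the last one read. Before the first read
  the bottom value is the default 1, which a grade may equal.\<close>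

lemma grade_less_bottom:
  assumes "history m D H" "i < m" "R \<in> objects D" "R \<notin> set (take (sorted_pos H i) (sorted_list D i))"
  shows "grade D R i \<le> bottom H i" "0 < sorted_pos H i \<Longrightarrow> grade D R i < bottom H i"
proof -
  obtain q where q: "sorted_pos H i \<le> q" "q < N" "R = sorted_list D i ! q"
    using unread_index assms by metis
  show "grade D R i < bottom H i" if "0 < sorted_pos H i"
    using q that assms bottom_eq[of H i] grade_strict[of i "sorted_pos H i - 1" q] by simp
  then show "grade D R i \<le> bottom H i"
    using q assms bottom_eq[of H i] grade_le_1[of R i] by (cases "sorted_pos H i = 0") auto
qed

text \<open>Bottom values depend on positions only, so the two histories may stem from different
  algorithms; this later compares CA with its competitor.\<close>

lemma bottom_antimono:
  assumes "history m D H" "history m D H'" "i < m"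
    and "sorted_pos H i \<le> sorted_pos H' i" "sorted_pos H' i \<le> N"
  shows "bottom H' i \<le> bottom H i"
  using assms bottom_eq[of H i] bottom_eq[of H' i]
    grade_le_1[OF nth_list[of i "sorted_pos H' i - 1"], of i]
    grade_strict[of i "sorted_pos H i - 1" "sorted_pos H' i - 1"]
  by (cases "sorted_pos H i = sorted_pos H' i"; cases "sorted_pos H i = 0") (auto intro: less_imp_le)

section \<open>The bounds \<open>W\<close> and \<open>B\<close> enclose the overall grade\<close>

lemma W_bound_le_overall:
  assumes "history m D H" "R \<in> objects D"
  shows "W_bound m H R \<le> overall m D R"
  unfolding W_bound_def overall_def
  using assms field_value grade_nonneg by (intro agg_min_mono m_pos) auto

lemma overall_le_B_bound:
  assumes "history m D H" "R \<in> objects D"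
  shows "overall m D R \<le> B_bound m H R"
  unfolding B_bound_def overall_def
  using assms field_value grade_less_bottom(1) fields_iff by (intro agg_min_mono m_pos) auto

lemma bounds_known:
  assumes "history m D H" "{..<m} \<subseteq> fields H R"
  shows "W_bound m H R = overall m D R" "B_bound m H R = overall m D R"
  unfolding W_bound_def B_bound_def overall_def
  using assms field_value by (auto intro!: agg_min_cong)

lemma B_bound_unseen: "R \<notin> seen H \<Longrightarrow> B_bound m H R = agg_min m (bottom H)"
  by (simp add: seen_def B_bound_def)

end

section \<open>The adversary argument\<close>

lemma run_mono:
  assumes "n \<le> n'"
  shows "set (run m A D n) \<subseteq> set (run m A D n')"
    and "sorted_pos (run m A D n) i \<le> sorted_pos (run m A D n') i"
  using assms
proof (induction rule: dec_induct)
  case (step n')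
  {
    case 1
    then show ?case using step set_perform_mono by fastforce
  next
    case 2
    then show ?case using step by (simp add: sorted_pos_perform)
  }
qed auto

text \<open>Indistinguishability: moves depend on the history alone, so if \<open>D'\<close> answers
  every access made on \<open>D\<close> in the same way, both runs agree by induction.\<close>

lemma run_transfer:
  assumes sorted: "\<And>i p. i < m \<Longrightarrow> p < sorted_pos (run m A D n) i \<Longrightarrow>
      p < length (sorted_list D i) \<and> p < length (sorted_list D' i) \<and>
      sorted_list D' i ! p = sorted_list D i ! p \<and>
      grade D' (sorted_list D i ! p) i = grade D (sorted_list D i ! p) i"
    and random: "\<And>R j v. RandomEv R j v \<in> set (run m A D n) \<Longrightarrow>
      v = (if j < m \<and> R \<in> objects D' then Some (grade D' R j) else None)"
    and "n' \<le> n"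
  shows "run m A D' n' = run m A D n'"
  using \<open>n' \<le> n\<close>
proof (induction n')
  case (Suc n')
  let ?H = "run m A D n'"
  let ?a = "A ?H"
  note mono = run_mono[OF Suc.prems, of m A D]
  have "perform m D' ?H ?a = perform m D ?H ?a"
  proof (cases ?a)
    case (Sorted i)
    then have "sorted_pos ?H i < sorted_pos (run m A D n) i"
      using mono(2)[of i] by (simp add: sorted_pos_perform)
    then show ?thesis
      using Sorted sorted[of i "sorted_pos ?H i"] by simp
  next
    case (Random R j)
    then have "RandomEv R j (if j < m \<and> R \<in> objects D then Some (grade D R j) else None)
        \<in> set (run m A D n)"
      using mono(1) by simp
    from random[OF this] show ?thesis using Random by simp
  qed simp
  then show ?case using Suc by simp
qed simp

text \<open>Open intervals are infinite, so the values can be picked one by one. They serve as new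
  grades that keep the altered database distinct.\<close>

lemma ex_inj_between:
  fixes lo hi :: "'b \<Rightarrow> real"
  assumes "finite U" "finite F" "\<And>u. u \<in> U \<Longrightarrow> lo u < hi u"
  shows "\<exists>f. inj_on f U \<and> (\<forall>u\<in>U. lo u < f u \<and> f u < hi u \<and> f u \<notin> F)"
  using assms
proof (induction U rule: finite_induct)
  case (insert u U)
  then obtain f where f: "inj_on f U" "\<forall>u\<in>U. lo u < f u \<and> f u < hi u \<and> f u \<notin> F" by auto
  have "infinite ({lo u<..<hi u} - (F \<union> f ` U))"
    using insert infinite_Ioo[of "lo u" "hi u"] by simp
  then obtain y where y: "lo u < y" "y < hi u" "y \<notin> F \<union> f ` U"
    by (metis Diff_iff ex_in_conv finite.emptyI greaterThanLessThan_iff)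
  have "inj_on (f(u := y)) (insert u U)"
    using insert(2) f(1) y(3) by (auto simp: inj_on_def)
  moreover have "\<forall>v\<in>insert u U. lo v < (f(u := y)) v \<and> (f(u := y)) v < hi v \<and> (f(u := y)) v \<notin> F"
    using f(2) y insert(2) by auto
  ultimately show ?case by blast
qed simp

text \<open>Used to complete the prefix already read to a full list of the altered database, by
  sorting the remaining objects.\<close>

lemma ex_sorted_extension:
  fixes g :: "'b \<Rightarrow> real"
  assumes "finite U" "distinct xs" "set xs \<subseteq> U" "sorted_wrt (\<lambda>R R'. g R \<ge> g R') xs"
    and "\<And>R R'. R \<in> set xs \<Longrightarrow> R' \<in> U - set xs \<Longrightarrow> g R' \<le> g R"
  shows "\<exists>ys. distinct (xs @ ys) \<and> set (xs @ ys) = U \<and> sorted_wrt (\<lambda>R R'. g R \<ge> g R') (xs @ ys)"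
proof -
  obtain zs where zs: "set zs = U - set xs" "distinct zs"
    using assms(1) finite_distinct_list by blast
  let ?ys = "sort_key (\<lambda>R. - g R) zs"
  have "sorted_wrt (\<lambda>R R'. g R \<ge> g R') ?ys"
    using sorted_sort_key[of "\<lambda>R. - g R" zs] by (simp add: sorted_wrt_map)
  then show ?thesis
    using assms zs by (intro exI[of _ ?ys]) (auto simp: sorted_wrt_append)
qed

context ranked_database
begin

lemma bottom_le_1: "history m D H \<Longrightarrow> i < m \<Longrightarrow> sorted_pos H i \<le> N \<Longrightarrow> bottom H i \<le> 1"
  using bottom_eq[of H i] grade_le_1[OF nth_list[of i "sorted_pos H i - 1"], of i] by auto

lemma bottom_le_read:
  assumes "history m D H" "i < m" "sorted_pos H i \<le> N" "R \<in> set (take (sorted_pos H i) (sorted_list D i))"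
  shows "bottom H i \<le> grade D R i"
proof -
  obtain p where p: "p < sorted_pos H i" "R = sorted_list D i ! p"
    using assms by (auto simp: in_set_conv_nth)
  then show ?thesis
    using bottom_eq[OF assms(1-3)] grade_strict[of i p "sorted_pos H i - 1"] assms
    by (cases "p = sorted_pos H i - 1") (auto intro: less_imp_le)
qed

text \<open>Makes the intervals for the altered grades nonempty: a nonnegative grade lies strictly
  below the bottom value, or that value is still 1.\<close>

lemma bottom_pos:
  assumes "history m D H" "i < m" "R \<in> objects D" "i \<notin> fields H R" "sorted_pos H i \<le> N"
  shows "0 < bottom H i"
proof (cases "sorted_pos H i = 0")
  case True
  then show ?thesis using assms bottom_eq by simp
next
  case False
  have "grade D R i < bottom H i"
    using False assms fields_iff by (intro grade_less_bottom(2)) auto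
  then show ?thesis using grade_nonneg[of R i] assms by simp
qed

text \<open>The fields that \<open>A\<close> has not seen may be raised almost to the bottom
  value for \<open>Z\<close> and lowered almost to 0 for all other objects without \<open>A\<close> noticing. The object
  \<open>Z\<close> need not even belong to the database.\<close>

lemma correct_output_bounds:
  assumes correct: "A \<in> correct_algorithms m k (distinct_databases m k)"
    and H_def: "H = final_history m A D" and Y: "A H = Halt Y"
    and pos_le: "\<And>i. i < m \<Longrightarrow> sorted_pos H i \<le> N"
    and Z: "Z \<notin> Y" "Z \<in> objects D \<or> (\<forall>i v. RandomEv Z i v \<notin> set H) \<and> (\<forall>i<m. 0 < bottom H i)"
    and R: "R \<in> Y"
  shows "B_bound m H Z \<le> W_bound m H R"
proof (rule field_le_epsilon)
  fix \<epsilon>' :: real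
  assume "0 < \<epsilon>'"
  \<comment> \<open>Unknown fields of \<open>Z\<close> will fall short of the bottom value by less
    than \<open>\<epsilon>\<close>, those of \<open>R\<close> will exceed 0 by less than
    \<open>\<epsilon>\<close>; the two errors add up.\<close>
  define \<epsilon> where "\<epsilon> = \<epsilon>' / 2"
  have \<epsilon>: "0 < \<epsilon>" using \<open>0 < \<epsilon>'\<close> by (simp add: \<epsilon>_def)
  have hist: "history m D H"
    using H_def history_run by (simp add: final_history_def)
  have "Y \<subseteq> objects D"
    using correct database H_def Y by (auto simp: correct_algorithms_def is_top_answer_def)
  then have "R \<in> objects D" "R \<noteq> Z" using R Z by auto
  define U where "U = insert Z (objects D)"
  have "finite U" using finite_objects by (simp add: U_def)
  have bottom_U: "0 < bottom H i" if "i < m" "S \<in> U" "i \<notin> fields H S" for i S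
    using that Z(2) bottom_pos[OF hist that(1) _ that(3) pos_le[OF that(1)]] by (auto simp: U_def)

  \<comment> \<open>Constraints on column \<open>i\<close> of the altered grades: known grades
    persist, and unknown ones stay below the bottom value so that the entries read remain the top of
    the list.\<close>
  define good where "good = (\<lambda>i g. inj_on g U \<and> (\<forall>S\<in>U. i \<in> fields H S \<longrightarrow> g S = grade D S i) \<and>
      (\<forall>S\<in>U. i \<notin> fields H S \<longrightarrow> 0 < g S \<and> g S < bottom H i \<and>
         (if S = Z then bottom H i - \<epsilon> < g S else g S < \<epsilon>)))"
  have "\<exists>g. good i g" if "i < m" for i
  proof -
    let ?lo = "\<lambda>S. if S = Z then max 0 (bottom H i - \<epsilon>) else 0"
    let ?hi = "\<lambda>S. if S = Z then bottom H i else min \<epsilon> (bottom H i)"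
    have lo_hi: "?lo S < ?hi S" if "S \<in> {S \<in> U. i \<notin> fields H S}" for S
      using that bottom_U[OF \<open>i < m\<close>, of S] \<epsilon> by auto
    \<comment> \<open>Avoiding all original grades keeps the new values apart from the known
      ones.\<close>
    obtain f where f: "inj_on f {S \<in> U. i \<notin> fields H S}"
      "\<forall>S\<in>{S \<in> U. i \<notin> fields H S}. ?lo S < f S \<and> f S < ?hi S \<and> f S \<notin> (\<lambda>S. grade D S i) ` objects D"
      using ex_inj_between[of "{S \<in> U. i \<notin> fields H S}" "(\<lambda>S. grade D S i) ` objects D" ?lo ?hi,
          OF _ finite_imageI[OF finite_objects] lo_hi] \<open>finite U\<close> by auto
    define g where "g = (\<lambda>S. if i \<in> fields H S then grade D S i else f S)"
    have known: "S \<in> objects D" if "i \<in> fields H S" for S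
      using that fields_iff[OF hist] by blast
    have fresh: "grade D S i \<noteq> f S'" if "S \<in> objects D" "S' \<in> U" "i \<notin> fields H S'" for S S'
    proof -
      have "f S' \<notin> (\<lambda>S. grade D S i) ` objects D" using f(2) that by simp
      then show ?thesis using imageI[OF that(1), of "\<lambda>S. grade D S i"] by auto
    qed
    have "g S \<noteq> g S'" if "S \<in> U" "S' \<in> U" "S \<noteq> S'" for S S'
      using that inj_onD[OF inj_grade[OF \<open>i < m\<close>], of S S'] inj_onD[OF f(1), of S S']
        known fresh[of S S'] fresh[of S' S] by (auto simp: g_def)
    then have "inj_on g U" by (auto intro: inj_onI)
    moreover have "\<forall>S\<in>U. i \<notin> fields H S \<longrightarrow> 0 < g S \<and> g S < bottom H i \<and>
         (if S = Z then bottom H i - \<epsilon> < g S else g S < \<epsilon>)"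
      using f(2) by (auto simp: g_def)
    ultimately show ?thesis by (intro exI[of _ g]) (auto simp: g_def good_def)
  qed
  then obtain g where g: "\<And>i. i < m \<Longrightarrow> good i (g i)" by metis
  then have g_inj: "\<And>i. i < m \<Longrightarrow> inj_on (g i) U"
    and g_known: "\<And>i S. i < m \<Longrightarrow> S \<in> U \<Longrightarrow> i \<in> fields H S \<Longrightarrow> g i S = grade D S i"
    and g_unknown: "\<And>i S. i < m \<Longrightarrow> S \<in> U \<Longrightarrow> i \<notin> fields H S \<Longrightarrow>
      0 < g i S \<and> g i S < bottom H i \<and> (if S = Z then bottom H i - \<epsilon> < g i S else g i S < \<epsilon>)"
    unfolding good_def by blast+

  let ?P = "\<lambda>i. take (sorted_pos H i) (sorted_list D i)"
  have P_known: "g i S = grade D S i" "S \<in> objects D" if "i < m" "S \<in> set (?P i)" for i S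
  proof -
    show "S \<in> objects D"
      using in_set_takeD[OF that(2)] set_list[OF that(1)] by simp
    then have "i \<in> fields H S" "S \<in> U"
      using that fields_iff[OF hist] by (auto simp: U_def)
    then show "g i S = grade D S i" using g_known[OF that(1)] by blast
  qed
  have "\<exists>ys. distinct (?P i @ ys) \<and> set (?P i @ ys) = U \<and>
      sorted_wrt (\<lambda>S S'. g i S \<ge> g i S') (?P i @ ys)" if "i < m" for i
  proof (rule ex_sorted_extension)
    show "distinct (?P i)" using distinct_list[OF that] by simp
    show "set (?P i) \<subseteq> U" using P_known[OF that] by (auto simp: U_def)
    have "sorted_wrt (\<lambda>S S'. grade D S i \<ge> grade D S' i) (?P i)"
      using sorted_list[OF that] by (rule sorted_wrt_take)
    then show "sorted_wrt (\<lambda>S S'. g i S \<ge> g i S') (?P i)"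
      by (rule sorted_wrt_mono_rel[rotated]) (use P_known that in auto)
    \<comment> \<open>The bottom value separates the entries read from all others.\<close>
    fix S S' assume S: "S \<in> set (?P i)" and S': "S' \<in> U - set (?P i)"
    have "g i S' \<le> bottom H i"
    proof (cases "i \<in> fields H S'")
      case True
      then show ?thesis
        using g_known[OF that _ True] S' fields_iff[OF hist, of i S'] grade_less_bottom(1)[OF hist that, of S']
        by auto
    next
      case False
      then show ?thesis using g_unknown[OF that _ False] S' by auto
    qed
    also have "bottom H i \<le> g i S"
      using bottom_le_read[OF hist that pos_le[OF that] S] P_known[OF that S] by simp
    finally show "g i S' \<le> g i S" .
  qed (fact \<open>finite U\<close>)
  then have "\<forall>i. \<exists>ys. i < m \<longrightarrow> distinct (?P i @ ys) \<and> set (?P i @ ys) = U \<and>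
      sorted_wrt (\<lambda>S S'. g i S \<ge> g i S') (?P i @ ys)" by blast
  from choice[OF this]
  obtain ys where ys: "\<And>i. i < m \<Longrightarrow> distinct (?P i @ ys i) \<and> set (?P i @ ys i) = U \<and>
      sorted_wrt (\<lambda>S S'. g i S \<ge> g i S') (?P i @ ys i)" by blast

  define D' where "D' = \<lparr>objects = U, grade = (\<lambda>S i. g i S), sorted_list = (\<lambda>i. ?P i @ ys i)\<rparr>"
  have g_range: "0 \<le> g i S \<and> g i S \<le> 1" if "i < m" "S \<in> U" for i S
  proof (cases "i \<in> fields H S")
    case True
    then show ?thesis
      using g_known[OF that True] fields_iff[OF hist, of i S] grade_nonneg grade_le_1 that by auto
  next
    case False
    then show ?thesis
      using g_unknown[OF that False] bottom_le_1[OF hist that(1) pos_le[OF that(1)]] by simp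
  qed
  have "N \<le> card U"
    using \<open>finite U\<close> by (auto simp: U_def intro: card_mono)
  then have D': "D' \<in> distinct_databases m k"
    using \<open>finite U\<close> k_le_N g_range g_inj ys
    by (auto simp: distinct_databases_def databases_def distinctness_def D'_def)

  obtain n Y' where n: "A (run m A D n) = Halt Y'" "H = run m A D n"
    "\<And>n' Y'. n' < n \<Longrightarrow> A (run m A D n') \<noteq> Halt Y'"
    using halting_run[of m A D] correct database H_def by (auto simp: correct_algorithms_def)
  have same: "run m A D' n' = run m A D n'" if "n' \<le> n" for n'
  proof (rule run_transfer[OF _ _ that])
    fix i p assume "i < m" "p < sorted_pos (run m A D n) i"
    then show "p < length (sorted_list D i) \<and> p < length (sorted_list D' i) \<and>
      sorted_list D' i ! p = sorted_list D i ! p \<and>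
      grade D' (sorted_list D i ! p) i = grade D (sorted_list D i ! p) i"
      using n(2) pos_le[of i] length_list[of i] P_known(1)[of i "sorted_list D i ! p"]
      by (force simp: D'_def nth_append in_set_conv_nth)
  next
    fix S j v assume ev: "RandomEv S j v \<in> set (run m A D n)"
    \<comment> \<open>A \<open>Z\<close> outside the database was never accessed at random, so no
      recorded \<open>None\<close> contradicts its presence in \<open>D'\<close>.\<close>
    have "S \<in> objects D" if "S \<in> U"
      using that ev n(2) Z(2) by (auto simp: U_def)
    moreover have "g j S = grade D S j" if "S \<in> objects D" "j < m"
      using that ev n(2) fields_iff[OF hist, of j S] by (intro g_known) (auto simp: U_def)
    ultimately show "v = (if j < m \<and> S \<in> objects D' then Some (grade D' S j) else None)"
      using random_event_result[OF hist, of S j v] ev n(2) by (auto simp: D'_def U_def)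
  qed
  have "final_history m A D' = H"
    using final_history_eq[of A m D' n Y] same n Y by simp
  then have top: "is_top_answer m k D' Y"
    using correct D' Y by (auto simp: correct_algorithms_def)
  have "overall m D' Z \<le> overall m D' R"
    using top R Z(1) by (auto simp: is_top_answer_def D'_def U_def)
  moreover have "B_bound m H Z - \<epsilon> \<le> overall m D' Z"
  proof -
    have "B_bound m H Z - \<epsilon> \<le> grade D' Z i" if "i < m" for i
    proof -
      have "B_bound m H Z \<le> (if i \<in> fields H Z then field_value H Z i else bottom H i)"
        unfolding B_bound_def by (rule agg_min_le[OF that])
      then show ?thesis
        using g_known[OF that, of Z] g_unknown[OF that, of Z] field_value[OF hist, of i Z] \<epsilon>
        by (auto simp: D'_def U_def split: if_splits)
    qed
    then show ?thesis using m_pos by (simp add: overall_def agg_min_ge_iff)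
  qed
  moreover have "overall m D' R \<le> W_bound m H R + \<epsilon>"
  proof -
    obtain i where i: "i < m" "W_bound m H R = (if i \<in> fields H R then field_value H R i else 0)"
      using agg_min_attained[OF m_pos] unfolding W_bound_def by blast
    have "overall m D' R \<le> grade D' R i"
      using i by (simp add: overall_def agg_min_le)
    then show ?thesis
      using g_known[OF i(1), of R] g_unknown[OF i(1), of R] field_value[OF hist, of i R] i(2) \<epsilon>
        \<open>R \<in> objects D\<close> \<open>R \<noteq> Z\<close> by (auto simp: D'_def U_def split: if_splits)
  qed
  ultimately show "B_bound m H Z \<le> W_bound m H R + \<epsilon>'"
    by (simp add: \<epsilon>_def)
qed

end

section \<open>Selecting the current top \<open>k\<close> objects\<close>

lemma ex_lex_max:
  fixes f g :: "'b \<Rightarrow> real"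
  assumes "finite S" "S \<noteq> {}"
  shows "\<exists>x\<in>S. \<forall>y\<in>S. f y < f x \<or> (f y = f x \<and> g y \<le> g x)"
proof -
  let ?F = "{x \<in> S. f x = Max (f ` S)}"
  have "Max (f ` S) \<in> f ` S" using assms by (intro Max_in) auto
  then have "?F \<noteq> {}" by auto
  then have "Max (g ` ?F) \<in> g ` ?F" using assms by (intro Max_in) auto
  then obtain x where x: "x \<in> S" "f x = Max (f ` S)" "g x = Max (g ` ?F)" by auto
  have "f y \<le> f x" if "y \<in> S" for y using that assms x by simp
  moreover have "g y \<le> g x" if "y \<in> S" "f y = f x" for y
    using that assms x by (auto intro!: Max_ge)
  ultimately show ?thesis using x(1) by (metis less_le)
qed

text \<open>Greedy construction: extend by a lexicographic maximum of the remaining seen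
  objects.\<close>

lemma ex_is_T:
  assumes "finite (seen H)" "j \<le> card (seen H)"
  shows "\<exists>T. is_T m j H T"
  using assms(2)
proof (induction j)
  case 0
  then show ?case by (intro exI[of _ "{}"]) (simp add: is_T_def)
next
  case (Suc j)
  then obtain T where T: "is_T m j H T" by auto
  then have "finite T" "card T < card (seen H)" "T \<subseteq> seen H"
    using Suc.prems assms(1) by (auto simp: is_T_def intro: finite_subset)
  then have "finite (seen H - T)" "seen H - T \<noteq> {}"
    using assms(1) by (auto simp: card_mono dest: subset_antisym)
  then obtain R where R: "R \<in> seen H - T" "\<forall>R'\<in>seen H - T. W_bound m H R' < W_bound m H R \<or>
      (W_bound m H R' = W_bound m H R \<and> B_bound m H R' \<le> B_bound m H R)"
    using ex_lex_max[of "seen H - T" "W_bound m H" "B_bound m H"] by blast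
  have "is_T m (Suc j) H (insert R T)"
    using T R \<open>finite T\<close> by (auto simp: is_T_def)
  then show ?case by blast
qed

lemma is_T_W_le: "is_T m k H T \<Longrightarrow> R \<in> T \<Longrightarrow> R' \<in> seen H - T \<Longrightarrow> W_bound m H R' \<le> W_bound m H R"
  unfolding is_T_def by (metis less_imp_le order_refl)

text \<open>Otherwise every object of \<open>S\<close> would beat \<open>R\<close> and hence lie in
  \<open>T - {R}\<close>, which has fewer than \<open>k\<close> elements.\<close>

lemma is_T_W_ge:
  assumes T: "is_T m k H T" and S: "S \<subseteq> seen H" "finite S" "k \<le> card S" "\<And>R. R \<in> S \<Longrightarrow> x \<le> W_bound m H R"
    and R: "R \<in> T" and fin: "finite (seen H)"
  shows "x \<le> W_bound m H R"
proof (rule ccontr)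
  assume less: "\<not> x \<le> W_bound m H R"
  have "S \<subseteq> T - {R}"
  proof
    fix R' assume R': "R' \<in> S"
    have "W_bound m H R < W_bound m H R'" using S(4)[OF R'] less by simp
    then show "R' \<in> T - {R}" using is_T_W_le[OF T R, of R'] R' S(1) by auto
  qed
  moreover have "finite T" using T fin by (auto simp: is_T_def intro: finite_subset)
  ultimately have "card S < card T" using R by (meson card_Diff1_less card_mono finite_Diff le_less_trans)
  then show False using T S(3) by (simp add: is_T_def)
qed

text \<open>The definite description is legitimate because any two admissible sets have the same
  least \<open>W\<close>: \<open>is_T_W_ge\<close> applies in both directions.\<close>

lemma M_bound_eq:
  assumes "is_T m k H T" "0 < k" "finite (seen H)"
  shows "M_bound m k H = Min (W_bound m H ` T)"
proof -
  have nonempty: "finite T" "T \<noteq> {}" if "is_T m k H T" for T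
    using that assms(2,3) by (auto simp: is_T_def intro: finite_subset)
  have "Min (W_bound m H ` T') \<le> Min (W_bound m H ` T)" if "is_T m k H T" "is_T m k H T'" for T T'
  proof -
    have "Min (W_bound m H ` T') \<le> W_bound m H R" if "R \<in> T" for R
      using \<open>is_T m k H T'\<close> nonempty[OF \<open>is_T m k H T'\<close>] assms(3)
      by (intro is_T_W_ge[OF \<open>is_T m k H T\<close> _ _ _ _ that, of T']) (auto simp: is_T_def)
    then show ?thesis using nonempty[OF \<open>is_T m k H T\<close>] by (subst Min_ge_iff) auto
  qed
  then show ?thesis unfolding M_bound_def using assms(1) by (intro the_equality) (auto intro: antisym)
qed

lemma
  assumes "is_T m k H T" "0 < k" "finite (seen H)"
  shows M_bound_le: "R \<in> T \<Longrightarrow> M_bound m k H \<le> W_bound m H R"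
    and W_bound_le_M: "R \<in> seen H - T \<Longrightarrow> W_bound m H R \<le> M_bound m k H"
    and M_bound_ge: "S \<subseteq> seen H \<Longrightarrow> k \<le> card S \<Longrightarrow> (\<And>R. R \<in> S \<Longrightarrow> x \<le> W_bound m H R) \<Longrightarrow>
      x \<le> M_bound m k H"
proof -
  note M = M_bound_eq[OF assms]
  have T: "finite T" "T \<noteq> {}"
    using assms by (auto simp: is_T_def intro: finite_subset)
  show "R \<in> T \<Longrightarrow> M_bound m k H \<le> W_bound m H R"
    using T by (simp add: M)
  have "Min (W_bound m H ` T) \<in> W_bound m H ` T"
    using T by (intro Min_in) auto
  then obtain R\<^sub>0 where R\<^sub>0: "R\<^sub>0 \<in> T" "M_bound m k H = W_bound m H R\<^sub>0"
    by (auto simp: M)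
  show "R \<in> seen H - T \<Longrightarrow> W_bound m H R \<le> M_bound m k H"
    using is_T_W_le[OF assms(1) R\<^sub>0(1)] R\<^sub>0(2) by simp
  show "x \<le> M_bound m k H" if "S \<subseteq> seen H" "k \<le> card S" "\<And>R. R \<in> S \<Longrightarrow> x \<le> W_bound m H R"
    using is_T_W_ge[OF assms(1) that(1) _ that(2,3) R\<^sub>0(1) assms(3)] R\<^sub>0(2)
      finite_subset[OF that(1) assms(3)] by simp
qed


section \<open>Runs of CA\<close>

text \<open>Histories CA can reach before halting under any resolution of its choices, so that
  invariants need not mention a tie breaker.\<close>

inductive CA_history :: "nat \<Rightarrow> nat \<Rightarrow> nat \<Rightarrow> 'a database \<Rightarrow> 'a event list \<Rightarrow> bool" for m k h D where
  Nil: "CA_history m k h D []"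
| step: "CA_history m k h D H \<Longrightarrow> a \<in> CA_moves m k h H \<Longrightarrow> (\<And>Y. a \<noteq> Halt Y) \<Longrightarrow>
    CA_history m k h D (perform m D H a)"

lemma CA_history_history: "CA_history m k h D H \<Longrightarrow> history m D H"
  by (induction rule: CA_history.induct) (auto intro: history.intros)

lemma depth_le: "i < m \<Longrightarrow> depth m H \<le> sorted_pos H i"
  by (auto simp: depth_def intro!: Min_le)

lemma depth_attained: "0 < m \<Longrightarrow> \<exists>i<m. depth m H = sorted_pos H i"
  using Min_in[of "sorted_pos H ` {..<m}"] unfolding depth_def by fastforce

lemma depth_Nil [simp]: "0 < m \<Longrightarrow> depth m [] = 0"
  using depth_attained[of m "[]"] by auto

lemma CA_moves_cases:
  assumes "a \<in> CA_moves m k h H" "\<And>Y. a \<noteq> Halt Y"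
  obtains (Sorted) i where "a = Sorted i" "i < m" "sorted_pos H i = depth m H"
      "\<not> round_complete m H \<or> pending m k h H = {} \<and> halting_moves m k H = {}"
    | (Random) R i where "a = Random R i" "round_complete m H" "Random R i \<in> pending m k h H"
proof -
  have "a \<in> next_sorted m H \<and> (\<not> round_complete m H \<or> pending m k h H = {} \<and> halting_moves m k H = {})
      \<or> round_complete m H \<and> a \<in> pending m k h H"
    using assms by (auto simp: CA_moves_def halting_moves_def split: if_splits)
  then show thesis
    using Sorted Random by (auto simp: next_sorted_def pending_def split: if_splits)
qed

locale CA_database = ranked_database +
  fixes h :: nat
  assumes h_pos: "0 < h"
begin

abbreviation "CA_hist \<equiv> CA_history m k h D"

text \<open>Only a list lagging behind advances, so the depth grows exactly when the round becomes
  complete.\<close>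

lemma depth_sorted:
  assumes "\<And>i. i < m \<Longrightarrow> sorted_pos H i \<le> Suc (depth m H)" "i < m" "sorted_pos H i = depth m H"
  defines "H' \<equiv> perform m D H (Sorted i)"
  shows "depth m H' = (if round_complete m H' then Suc (depth m H) else depth m H)"
    and "i' < m \<Longrightarrow> sorted_pos H' i' \<le> Suc (depth m H)"
proof -
  have pos: "sorted_pos H' j = sorted_pos H j + (if j = i then 1 else 0)" for j
    unfolding H'_def sorted_pos_perform by simp
  show pos_le: "sorted_pos H' i' \<le> Suc (depth m H)" if "i' < m" for i'
    using assms(1)[OF that] assms(3) by (simp add: pos)
  obtain j where j: "j < m" "depth m H' = sorted_pos H' j"
    using depth_attained[OF m_pos] by blast
  have "depth m H \<le> depth m H'"
    using depth_le[OF j(1), of H] j(2) pos by simp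
  moreover have "depth m H' \<le> Suc (depth m H)"
    using depth_le[OF assms(2), of H'] assms(3) pos by simp
  moreover have "depth m H' = Suc (depth m H)" if "round_complete m H'"
    using that assms(2,3) pos[of i] by (simp add: round_complete_def)
  moreover have "round_complete m H'" if "depth m H' = Suc (depth m H)"
    using that pos_le depth_le[of _ m H'] by (auto simp: round_complete_def intro: antisym)
  ultimately show "depth m H' = (if round_complete m H' then Suc (depth m H) else depth m H)"
    by (auto simp: le_Suc_eq)
qed

lemma depth_random [simp]:
  "depth m (perform m D H (Random R i)) = depth m H"
  "depth m (H @ [RandomEv R i v]) = depth m H"
  "round_complete m (H @ [RandomEv R i v]) \<longleftrightarrow> round_complete m H"
  by (simp_all add: depth_def round_complete_def)

lemma CA_hist_pos_le:
  "CA_hist H \<Longrightarrow> i < m \<Longrightarrow> sorted_pos H i \<le> Suc (depth m H)"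
proof (induction arbitrary: i rule: CA_history.induct)
  case (step H a)
  from step.hyps(2,3) show ?case
  proof (cases rule: CA_moves_cases)
    case (Sorted j)
    then have "sorted_pos (perform m D H a) i \<le> Suc (depth m H)"
      using depth_sorted(2)[of H j i] step by blast
    also have "depth m H \<le> depth m (perform m D H a)"
      using depth_sorted(1)[of H j] step Sorted by (auto split: if_splits)
    finally show ?thesis by simp
  next
    case (Random R j)
    then show ?thesis using step by simp
  qed
qed simp

lemma sorted_count:
  "CA_hist H \<Longrightarrow> length (filter is_sorted_ev H) = (\<Sum>i<m. sorted_pos H i)"
proof (induction rule: CA_history.induct)
  case (step H a)
  from step.hyps(2,3) show ?case
  proof (cases rule: CA_moves_cases)
    case (Sorted j)
    have "(\<Sum>i<m. sorted_pos (perform m D H a) i) = (\<Sum>i<m. sorted_pos H i) + (\<Sum>i<m. if i = j then 1 else 0)"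
      unfolding sorted_pos_perform sum.distrib[symmetric] using Sorted by (intro sum.cong) auto
    then show ?thesis
      using Sorted step.IH by simp
  qed (simp add: step.IH)
qed simp

lemma finite_seen: "history m D H \<Longrightarrow> finite (seen H)"
  using seen_subset finite_objects finite_subset by blast

lemma halting_moves_correct:
  assumes H: "history m D H" and Y: "Halt Y \<in> halting_moves m k H"
  shows "is_top_answer m k D Y"
proof -
  have T: "is_T m k H Y" and B: "\<And>R. R \<notin> Y \<Longrightarrow> B_bound m H R \<le> M_bound m k H"
    using Y by (auto simp: halting_moves_def)
  have Y_sub: "Y \<subseteq> objects D" using T seen_subset[OF H] by (auto simp: is_T_def)
  have "overall m D R' \<le> overall m D R" if "R \<in> Y" "R' \<in> objects D - Y" for R R'
  proof -
    have "overall m D R' \<le> B_bound m H R'" using overall_le_B_bound[OF H] that by blast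
    also have "\<dots> \<le> M_bound m k H" using B that by blast
    also have "\<dots> \<le> W_bound m H R" using M_bound_le[OF T k_pos finite_seen[OF H] that(1)] .
    also have "\<dots> \<le> overall m D R" using W_bound_le_overall[OF H] that Y_sub by blast
    finally show ?thesis .
  qed
  then show ?thesis using T Y_sub by (simp add: is_top_answer_def is_T_def)
qed

text \<open>Every object is now fully known, so \<open>B\<close> equals \<open>W\<close> on it. An
  object absent from the database has the minimum of the last grades as its \<open>B\<close> value,
  which no overall grade undercuts.\<close>

lemma halting_moves_exhausted:
  assumes H: "history m D H" and pos: "\<And>i. i < m \<Longrightarrow> sorted_pos H i = N"
  shows "halting_moves m k H \<noteq> {}"
proof -
  have known: "fields H R = {..<m}" if "R \<in> objects D" for R
    using that fields_iff[OF H] pos set_list length_list by auto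
  then have seen: "seen H = objects D"
    using seen_subset[OF H] m_pos by (auto simp: seen_def)
  then obtain T where T: "is_T m k H T"
    using ex_is_T[of H k m] k_le_N finite_objects by auto
  have "B_bound m H R \<le> M_bound m k H" if "R \<notin> T" for R
  proof (cases "R \<in> objects D")
    case True
    then have "B_bound m H R = W_bound m H R" using bounds_known[OF H] known by simp
    then show ?thesis using W_bound_le_M[OF T k_pos, of R] finite_objects seen True that by simp
  next
    case False
    have "B_bound m H R \<le> M_bound m k H"
    proof (rule M_bound_ge[OF T k_pos])
      show "B_bound m H R \<le> W_bound m H R'" if "R' \<in> objects D" for R'
      proof -
        have "bottom H i \<le> grade D R' i" if "i < m" for i
          using \<open>R' \<in> objects D\<close> bottom_le_read[OF H that] pos[OF that] set_list[OF that] length_list[OF that]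
          by simp
        then have "agg_min m (bottom H) \<le> overall m D R'"
          unfolding overall_def by (rule agg_min_mono[OF m_pos])
        then show ?thesis
          using B_bound_unseen[of R H] False seen bounds_known[OF H, of R'] known[OF that] by simp
      qed
    qed (use seen finite_objects k_le_N in auto)
    then show ?thesis .
  qed
  then show ?thesis
    using T seen k_le_N by (auto simp: halting_moves_def)
qed

text \<open>Another round at depth \<open>N\<close> would require that no halting move exists, but
  then all lists are exhausted.\<close>

lemma CA_hist_depth_le:
  "CA_hist H \<Longrightarrow> depth m H \<le> N \<and> (\<not> round_complete m H \<longrightarrow> depth m H < N)"
proof (induction rule: CA_history.induct)
  case Nil
  show ?case using k_le_N k_pos m_pos by (simp add: round_complete_def)
next
  case (step H a)
  from step.hyps(2,3) show ?case
  proof (cases rule: CA_moves_cases)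
    case (Sorted j)
    have "depth m H < N"
    proof (rule ccontr)
      assume "\<not> depth m H < N"
      then have "depth m H = N" "round_complete m H" using step.IH by auto
      then have "halting_moves m k H \<noteq> {}"
        using halting_moves_exhausted CA_history_history[OF step.hyps(1)] by (simp add: round_complete_def)
      then show False using Sorted \<open>round_complete m H\<close> by simp
    qed
    then show ?thesis
      using depth_sorted(1)[of H j] Sorted CA_hist_pos_le[OF step.hyps(1)] by auto
  next
    case (Random R j)
    then show ?thesis using step.IH by simp
  qed
qed

lemma CA_hist_pos_le_N: "CA_hist H \<Longrightarrow> i < m \<Longrightarrow> sorted_pos H i \<le> N"
  using CA_hist_depth_le[of H] CA_hist_pos_le[of H i]
  by (cases "round_complete m H") (auto simp: round_complete_def)

end

section \<open>Counting the phases\<close>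

text \<open>Reads off the history which object the current random access step has chosen; the next
  sorted access ends the step.\<close>

definition picked :: "'a event list \<Rightarrow> 'a \<Rightarrow> bool" where
  "picked H R \<longleftrightarrow> H \<noteq> [] \<and> (\<exists>i v. last H = RandomEv R i v)"

lemma picked_simps [simp]:
  "\<not> picked [] R" "\<not> picked (H @ [SortedEv i v]) R" "picked (H @ [RandomEv R' i w]) R \<longleftrightarrow> R = R'"
  by (auto simp: picked_def)

definition random_count :: "'a event list \<Rightarrow> nat" where
  "random_count H = length (filter (\<lambda>e. \<not> is_sorted_ev e) H)"

lemma random_count_simps [simp]:
  "random_count [] = 0"
  "random_count (perform m D H (Sorted i)) = random_count H"
  "random_count (perform m D H (Random R i)) = Suc (random_count H)"
  by (simp_all add: random_count_def)

lemma random_objects: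
  shows "finite {R. \<exists>i v. RandomEv R i v \<in> set H}"
    and "card {R. \<exists>i v. RandomEv R i v \<in> set H} \<le> random_count H"
proof -
  let ?X = "(\<lambda>e. case e of SortedEv _ _ \<Rightarrow> undefined | RandomEv R _ _ \<Rightarrow> R) `
    set (filter (\<lambda>e. \<not> is_sorted_ev e) H)"
  have sub: "{R. \<exists>i v. RandomEv R i v \<in> set H} \<subseteq> ?X"
    by (force simp: image_iff)
  then show "finite {R. \<exists>i v. RandomEv R i v \<in> set H}"
    using finite_subset by blast
  have "card {R. \<exists>i v. RandomEv R i v \<in> set H} \<le> card ?X"
    using sub by (intro card_mono) auto
  also have "\<dots> \<le> random_count H"
    unfolding random_count_def by (meson card_image_le card_length finite_set order_trans)
  finally show "card {R. \<exists>i v. RandomEv R i v \<in> set H} \<le> random_count H" .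
qed

lemma pending_iff:
  assumes "0 < m"
  shows "Random R i \<in> pending m k h H \<longleftrightarrow> 0 < depth m H \<and> h dvd depth m H \<and> i < m \<and> i \<notin> fields H R \<and>
    (picked H R \<or> (\<forall>R'. \<not> picked H R') \<and> R \<in> best_candidates m k H)"
\<comment> \<open>\<open>last []\<close> is unspecified, but nothing is pending at depth 0.\<close>
proof (cases "H = []")
  case True
  then show ?thesis using assms by (simp add: pending_def)
next
  case False
  then show ?thesis
    by (cases "last H") (auto simp: pending_def picked_def)
qed

lemma div_pred_not_dvd: "0 < j \<Longrightarrow> \<not> h dvd j \<Longrightarrow> j div h = (j - 1) div (h::nat)"
  by (cases j) (auto simp: div_Suc dvd_eq_mod_eq_0)

lemma div_pred_dvd: "0 < j \<Longrightarrow> h dvd j \<Longrightarrow> j div h = Suc ((j - 1) div (h::nat))"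
  by (cases j) (auto simp: div_Suc dvd_eq_mod_eq_0)

context CA_database
begin

text \<open>A phase is the random access step at a depth divisible by \<open>h\<close>. Here \<open>G j H\<close> says that \<open>H\<close> is
  in order with the phases up to depth \<open>j\<close> accounted for, \<open>E R H\<close> that it is so once the
  accesses to the object \<open>R\<close> picked in the current phase are completed.\<close>

lemma CA_hist_invariant:
  assumes "CA_hist H"
    and init: "G 0 []"
    and read: "\<And>H i j. history m D H \<Longrightarrow> G j H \<Longrightarrow> G j (perform m D H (Sorted i))"
    and skip: "\<And>H. CA_hist H \<Longrightarrow> round_complete m H \<Longrightarrow> G (depth m H - 1) H \<Longrightarrow> 0 < depth m H \<Longrightarrow>
      halting_moves m k H = {} \<Longrightarrow> (h dvd depth m H \<Longrightarrow> best_candidates m k H = {}) \<Longrightarrow> G (depth m H) H"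
    and pick: "\<And>H R i. CA_hist H \<Longrightarrow> round_complete m H \<Longrightarrow> G (depth m H - 1) H \<Longrightarrow> 0 < depth m H \<Longrightarrow>
      h dvd depth m H \<Longrightarrow> R \<in> best_candidates m k H \<Longrightarrow> i < m \<Longrightarrow> i \<notin> fields H R \<Longrightarrow>
      E R (perform m D H (Random R i))"
    and continue: "\<And>H R i. CA_hist H \<Longrightarrow> E R H \<Longrightarrow> i < m \<Longrightarrow> i \<notin> fields H R \<Longrightarrow>
      E R (perform m D H (Random R i))"
    and finish: "\<And>H R. E R H \<Longrightarrow> {..<m} \<subseteq> fields H R \<Longrightarrow> G (depth m H) H"
  shows "(\<not> round_complete m H \<longrightarrow> G (depth m H) H) \<and>
    (round_complete m H \<longrightarrow> (\<forall>R. \<not> picked H R) \<longrightarrow> G (depth m H - 1) H) \<and>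
    (\<forall>R. round_complete m H \<longrightarrow> picked H R \<longrightarrow> 0 < depth m H \<and> h dvd depth m H \<and> E R H)"
  using assms(1)
proof (induction rule: CA_history.induct)
  case Nil
  show ?case using init m_pos by (simp add: round_complete_def)
next
  case (step H a)
  from step.hyps(2,3) show ?case
  proof (cases rule: CA_moves_cases)
    case (Sorted i)
    have "G (depth m H) H"
    proof (cases "round_complete m H")
      case False
      then show ?thesis using step.IH by simp
    next
      case True
      then have none: "pending m k h H = {}" and halt: "halting_moves m k H = {}" using Sorted by auto
      show ?thesis
      proof (cases "\<exists>R. picked H R")
        case picked: True
        then obtain R where R: "picked H R" by blast
        then have "0 < depth m H" "h dvd depth m H" "E R H"
          using step.IH True by auto
        \<comment> \<open>With nothing pending, the picked object has no missing field left.\<close>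
        moreover have "{..<m} \<subseteq> fields H R"
          using none pending_iff[OF m_pos, of R _ k h H] R calculation by auto
        ultimately show ?thesis by (intro finish) auto
      next
        case not_picked: False
        then have G: "G (depth m H - 1) H" using step.IH True by simp
        show ?thesis
        \<comment> \<open>At depth 0 truncated subtraction makes \<open>depth m H - 1\<close> equal
          to \<open>depth m H\<close>.\<close>
        proof (cases "depth m H = 0")
          case nonzero: False
          \<comment> \<open>A best candidate has a missing field, and its request would be
            pending.\<close>
          have "best_candidates m k H = {}" if "h dvd depth m H"
          proof -
            have "\<not> {..<m} \<subseteq> fields H R" if "R \<in> best_candidates m k H" for R
              using that by (simp add: best_candidates_def candidates_def)
            then show ?thesis
              using none pending_iff[OF m_pos, of _ _ k h H] not_picked nonzero that by blast
          qed
          then show ?thesis using skip[OF step.hyps(1) True G _ halt] nonzero by simp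
        qed (use G in simp)
      qed
    qed
    then have "G (depth m H) (perform m D H a)"
      using read CA_history_history[OF step.hyps(1)] Sorted(1) by simp
    moreover have "\<not> picked (perform m D H a) R" for R
      using Sorted(1) by simp
    ultimately show ?thesis
      using depth_sorted(1)[OF CA_hist_pos_le[OF step.hyps(1)] Sorted(2,3)] Sorted(1)
      by (simp split: if_splits del: perform.simps)
  next
    case (Random R i)
    then have p: "0 < depth m H" "h dvd depth m H" "i < m" "i \<notin> fields H R"
      "picked H R \<or> (\<forall>R'. \<not> picked H R') \<and> R \<in> best_candidates m k H"
      using Random(3) unfolding pending_iff[OF m_pos] by simp_all
    have "E R (perform m D H a)"
    proof (cases "picked H R")
      case True
      then show ?thesis
        using continue[OF step.hyps(1) _ p(3,4)] p(5) step.IH Random(1,2) by auto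
    next
      case False
      then show ?thesis
        using pick[OF step.hyps(1) Random(2) _ p(1,2) _ p(3,4)] p(5) step.IH Random(1,2) by auto
    qed
    then show ?thesis using Random p(1,2) by simp
  qed
qed

lemma fields_random:
  assumes "history m D H" "i < m" "R \<in> objects D"
  shows "fields (perform m D H (Random R i)) R = insert i (fields H R)"
  using assms by (auto simp: fields_def reveals_def)

lemma best_candidates_objects:
  "CA_hist H \<Longrightarrow> R \<in> best_candidates m k H \<Longrightarrow> R \<in> objects D"
  using seen_subset[OF CA_history_history] by (auto simp: best_candidates_def candidates_def)

text \<open>Each phase requests at most \<open>m\<close> fields. The missing fields of the picked
  object are charged in advance, so each access leaves the sum in \<open>E\<close>
  unchanged.\<close>

lemma random_count_le:
  assumes "CA_hist H"
  shows "random_count H \<le> m * (depth m H div h)"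
proof -
  define missing where "missing = (\<lambda>H (R :: 'a). card ({..<m} - fields H R))"
  define G where "G = (\<lambda>j (H :: 'a event list). random_count H \<le> m * (j div h))"
  define E where "E = (\<lambda>R H. R \<in> objects D \<and> random_count H + missing H R \<le> m * (depth m H div h))"
  have missing: "Suc (missing (perform m D H (Random R i)) R) = missing H R"
    if "CA_hist H" "R \<in> objects D" "i < m" "i \<notin> fields H R" for H R i
  proof -
    have "Suc (card ({..<m} - fields H R - {i})) = card ({..<m} - fields H R)"
      using that by (intro card_Suc_Diff1) auto
    then show ?thesis
      unfolding missing_def fields_random[OF CA_history_history[OF that(1)] that(3,2)]
      by (simp only: Diff_insert[of _ i "fields H R"])
  qed
  have G_mono: "G j H \<Longrightarrow> j \<le> j' \<Longrightarrow> G j' H" for j j' H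
    unfolding G_def by (meson div_le_mono mult_le_mono2 order_trans)
  have inv: "(\<not> round_complete m H \<longrightarrow> G (depth m H) H) \<and>
    (round_complete m H \<longrightarrow> (\<forall>R. \<not> picked H R) \<longrightarrow> G (depth m H - 1) H) \<and>
    (\<forall>R. round_complete m H \<longrightarrow> picked H R \<longrightarrow> 0 < depth m H \<and> h dvd depth m H \<and> E R H)"
    using assms
  proof (rule CA_hist_invariant)
    fix H R i
    assume H: "CA_hist H" "G (depth m H - 1) H" "0 < depth m H" "h dvd depth m H"
      and R: "R \<in> best_candidates m k H" and i: "i < m" "i \<notin> fields H R"
    have "R \<in> objects D" using best_candidates_objects[OF H(1) R] .
    moreover have "missing H R \<le> m"
      unfolding missing_def using card_mono[of "{..<m}" "{..<m} - fields H R"] by simp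
    ultimately show "E R (perform m D H (Random R i))"
      using H(2) missing[OF H(1) _ i] div_pred_dvd[OF H(3,4)]
      by (simp add: E_def G_def del: perform.simps)
  next
    fix H R i
    assume H: "CA_hist H" "E R H" and i: "i < m" "i \<notin> fields H R"
    then show "E R (perform m D H (Random R i))"
      using missing[OF H(1) _ i] by (simp add: E_def del: perform.simps)
  qed (use G_mono in \<open>auto simp: G_def E_def simp del: perform.simps\<close>)
  show ?thesis
    using inv G_mono[of "depth m H - 1" H "depth m H"] by (auto simp: G_def E_def split: if_splits)
qed

text \<open>After depth \<open>d\<close>, every phase that CA survives either meets a new bottom
  value \<open>\<tau>\<close> in some list or completes a new object of \<open>C\<close>.\<close>

lemma phases_le:
  fixes \<tau> :: real and C :: "'a set"
  assumes "CA_hist H" and "finite C"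
    and picks: "\<And>H R. CA_hist H \<Longrightarrow> round_complete m H \<Longrightarrow> d \<le> depth m H \<Longrightarrow>
      (\<And>i. i < m \<Longrightarrow> bottom H i \<noteq> \<tau>) \<Longrightarrow> R \<in> best_candidates m k H \<Longrightarrow> R \<in> C"
    and halts: "\<And>H. CA_hist H \<Longrightarrow> round_complete m H \<Longrightarrow> d \<le> depth m H \<Longrightarrow>
      (\<And>i. i < m \<Longrightarrow> bottom H i \<noteq> \<tau>) \<Longrightarrow> best_candidates m k H = {} \<Longrightarrow> halting_moves m k H \<noteq> {}"
  shows "depth m H div h \<le> d div h + m + card C + 1"
proof -
  \<comment> \<open>The lists that have already shown the grade \<open>\<tau>\<close>. By
    distinctness each shows it at most once, so this can grow at most \<open>m\<close>
    times.\<close>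
  define L where "L = (\<lambda>j. {i. i < m \<and> \<tau> \<in> (\<lambda>R. grade D R i) ` set (take j (sorted_list D i))})"
  define K where "K = (\<lambda>H :: 'a event list. {R \<in> C. {..<m} \<subseteq> fields H R})"
  define G where "G = (\<lambda>j H. j div h \<le> d div h + card (L j) + card (K H))"
  \<comment> \<open>The picked object counts as completed in advance.\<close>
  define E where "E = (\<lambda>R H. R \<in> objects D \<and>
    depth m H div h \<le> d div h + card (L (depth m H)) + card (K H \<union> (C \<inter> {R})))"
  have fin: "finite (L j)" "finite (K H)" for j H using \<open>finite C\<close> by (simp_all add: L_def K_def)
  have L_sub: "L j \<subseteq> L j'" if "j \<le> j'" for j j'
    using subsetD[OF set_take_subset_set_take[OF that]] by (fastforce simp: L_def)
  have L_mono: "card (L j) \<le> card (L j')" if "j \<le> j'" for j j'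
    using fin(1) L_sub[OF that] by (rule card_mono)
  have K_mono: "K H \<subseteq> K (perform m D H a)" for H a
    using fields_perform_mono[of H _ a] by (auto simp: K_def)
  have L_less: "Suc (card (L (depth m H - 1))) \<le> card (L (depth m H))"
    if "CA_hist H" "round_complete m H" "0 < depth m H" "i < m" "bottom H i = \<tau>" for H i
  proof -
    let ?j = "depth m H" and ?xs = "sorted_list D i"
    have pos: "sorted_pos H i = ?j" using that by (simp add: round_complete_def)
    have "?j \<le> N" using CA_hist_depth_le that(1) by blast
    have \<tau>: "grade D (?xs ! (?j - 1)) i = \<tau>"
      using bottom_eq[OF CA_history_history[OF that(1)] that(4)] pos \<open>?j \<le> N\<close> that(3,5) by simp
    have "?xs ! (?j - 1) \<in> set (take ?j ?xs)"
      using that(3,4) \<open>?j \<le> N\<close> length_list by (auto simp: in_set_conv_nth intro!: exI[of _ "?j - 1"])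
    then have "i \<in> L ?j" using \<tau> that(4) by (auto simp: L_def)
    moreover have "i \<notin> L (?j - 1)"
    proof
      assume "i \<in> L (?j - 1)"
      then obtain p where "p < ?j - 1" "\<tau> = grade D (?xs ! p) i"
        by (auto simp: L_def in_set_conv_nth)
      moreover have "?j - 1 < N" using \<open>?j \<le> N\<close> that(3) by linarith
      ultimately show False using grade_strict[OF that(4), of p "?j - 1"] \<tau> by simp
    qed
    moreover have "L (?j - 1) \<subseteq> L ?j" by (rule L_sub) simp
    ultimately have "L (?j - 1) \<subset> L ?j" by blast
    then show ?thesis using fin(1) by (simp add: psubset_card_mono Suc_leI)
  qed
  have inv: "(\<not> round_complete m H \<longrightarrow> G (depth m H) H) \<and>
    (round_complete m H \<longrightarrow> (\<forall>R. \<not> picked H R) \<longrightarrow> G (depth m H - 1) H) \<and>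
    (\<forall>R. round_complete m H \<longrightarrow> picked H R \<longrightarrow> 0 < depth m H \<and> h dvd depth m H \<and> E R H)"
    using assms(1)
  proof (rule CA_hist_invariant)
    show "G 0 []" by (simp add: G_def)
  next
    fix H i j assume "G j H"
    then show "G j (perform m D H (Sorted i))"
      unfolding G_def using card_mono[OF fin(2) K_mono[of H "Sorted i"]] by linarith
  next
    fix H :: "'a event list"
    let ?j = "depth m H"
    assume H: "CA_hist H" "round_complete m H" "G (?j - 1) H" "0 < ?j" "halting_moves m k H = {}"
      "h dvd ?j \<Longrightarrow> best_candidates m k H = {}"
    \<comment> \<open>In a phase beyond depth \<open>d\<close> without bottom value
      \<open>\<tau>\<close>, the lack of candidates would provide a halting move.\<close>
    consider "\<not> h dvd ?j" | "?j \<le> d" | i where "h dvd ?j" "i < m" "bottom H i = \<tau>"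
      using halts[OF H(1,2)] H(5,6) by (metis nat_le_linear)
    then show "G ?j H"
    proof cases
      case 1
      then show ?thesis using H(3,4) div_pred_not_dvd[of ?j h] L_mono[of "?j - 1" ?j] by (simp add: G_def)
    next
      case 2
      then show ?thesis using div_le_mono[of ?j d h] by (simp add: G_def)
    next
      case (3 i)
      then show ?thesis
        using H(3) div_pred_dvd[OF H(4)] L_less[OF H(1,2,4) 3(2,3)] by (simp add: G_def)
    qed
  next
    fix H R i
    let ?j = "depth m H" and ?H = "perform m D H (Random R i)"
    assume H: "CA_hist H" "round_complete m H" "G (?j - 1) H" "0 < ?j" "h dvd ?j"
      and R: "R \<in> best_candidates m k H" and i: "i < m" "i \<notin> fields H R"
    have K_le: "card (K H) \<le> card (K ?H \<union> (C \<inter> {R}))"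
      using K_mono[of H "Random R i"] fin by (intro card_mono) auto
    consider "?j \<le> d" | i where "i < m" "bottom H i = \<tau>" | "R \<in> C"
      using picks[OF H(1,2) _ _ R] by (metis nat_le_linear)
    then have "?j div h \<le> d div h + card (L ?j) + card (K ?H \<union> (C \<inter> {R}))"
    proof cases
      case 1
      then show ?thesis using div_le_mono[of ?j d h] by simp
    next
      case (2 i)
      then show ?thesis
        using H(3) div_pred_dvd[OF H(4,5)] L_less[OF H(1,2,4) 2] K_le by (simp add: G_def)
    next
      case 3
      \<comment> \<open>A field of \<open>R\<close> is still missing, so \<open>R\<close> is counted
        here for the first time.\<close>
      have "R \<notin> K H" using i by (auto simp: K_def)
      then have "Suc (card (K H)) = card (insert R (K H))" using fin by simp
      also have "\<dots> \<le> card (K ?H \<union> (C \<inter> {R}))"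
        using 3 K_mono[of H "Random R i"] fin by (intro card_mono) auto
      finally show ?thesis
        using H(3) div_pred_dvd[OF H(4,5)] L_mono[of "?j - 1" ?j] by (simp add: G_def)
    qed
    then show "E R ?H" using best_candidates_objects[OF H(1) R] by (simp add: E_def del: perform.simps)
  next
    fix H R i
    assume "E R H"
    moreover have "card (K H \<union> (C \<inter> {R})) \<le> card (K (perform m D H (Random R i)) \<union> (C \<inter> {R}))"
      using K_mono[of H "Random R i"] fin by (intro card_mono) auto
    ultimately show "E R (perform m D H (Random R i))"
      by (simp add: E_def del: perform.simps)
  next
    fix H R
    assume E: "E R H" and "{..<m} \<subseteq> fields H R"
    then have "K H \<union> (C \<inter> {R}) = K H" by (auto simp: K_def)
    then show "G (depth m H) H" using E by (simp add: E_def G_def)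
  qed
  have L_le: "card (L j) \<le> m" for j
    using card_mono[of "{..<m}" "L j"] by (auto simp: L_def)
  have K_le: "card (K H) \<le> card C" "card (K H \<union> (C \<inter> {R})) \<le> card C" for R
    using \<open>finite C\<close> by (auto simp: K_def intro!: card_mono)
  \<comment> \<open>If the phase at the current depth is still open, \<open>G\<close> reaches only
    to the previous depth; this is the source of the final \<open>+ 1\<close>.\<close>
  have div: "depth m H div h \<le> Suc ((depth m H - 1) div h)"
    using div_pred_dvd[of "depth m H" h] div_pred_not_dvd[of "depth m H" h]
    by (cases "depth m H = 0"; cases "h dvd depth m H") auto
  consider "G (depth m H) H" | "G (depth m H - 1) H" | R where "E R H"
    using inv by blast
  then show ?thesis
  proof cases
    case 1
    then show ?thesis using L_le[of "depth m H"] K_le(1) unfolding G_def by linarith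
  next
    case 2
    then show ?thesis using L_le[of "depth m H - 1"] K_le(1) div unfolding G_def by linarith
  next
    case (3 R)
    then show ?thesis using L_le[of "depth m H"] K_le(2)[of R] unfolding E_def by linarith
  qed
qed

end

section \<open>Comparison with a correct algorithm\<close>

context CA_database
begin

text \<open>If \<open>M\<^sub>k\<close> is below \<open>\<tau>\<close>, some object of \<open>Y\<close> is still a candidate, so the object picked has
  \<open>B\<close> value at least \<open>\<tau>\<close>; otherwise its \<open>B\<close> value exceeds \<open>\<tau>\<close> by viability. An object outside
  \<open>Y\<close> that the competitor has not accessed at random has \<open>B\<close> value at most \<open>\<tau>\<close>, so the value is exactly \<open>\<tau>\<close>,
  attained at one of its known fields.\<close>

lemma phases_le_competitor:
  assumes HA: "history m D HA" and pos: "\<And>i. i < m \<Longrightarrow> sorted_pos HA i \<le> d"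
    and Y: "Y \<subseteq> objects D" "card Y = k" "\<And>R. R \<in> Y \<Longrightarrow> \<tau> \<le> overall m D R"
    and bottom_HA: "i\<^sub>0 < m" "bottom HA i\<^sub>0 \<le> \<tau>"
    and B_HA: "\<And>R. R \<in> objects D - Y \<Longrightarrow> B_bound m HA R \<le> \<tau>"
    and H: "CA_hist H"
  shows "depth m H div h \<le> d div h + random_count HA + 2 * m + k + 1"
proof -
  define P where "P = {R. \<exists>i v. RandomEv R i v \<in> set HA}"
  \<comment> \<open>Distinctness allows one such object per list, so \<open>T\<close> has at most
    \<open>m\<close> elements; with the \<open>m\<close> from \<open>phases_le\<close> this makes
    \<open>2 * m\<close>.\<close>
  define T where "T = (\<Union>i<m. {R \<in> objects D. grade D R i = \<tau>})"
  define C where "C = Y \<union> P \<union> T"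
  have fin: "finite Y" "finite P" "finite T"
    using finite_objects Y(1) random_objects(1) by (auto simp: P_def T_def intro: finite_subset)
  have "card {R \<in> objects D. grade D R i = \<tau>} \<le> 1" if "i < m" for i
    using inj_onD[OF inj_grade[OF that]] finite_objects by (auto simp: card_le_Suc0_iff_eq)
  then have "(\<Sum>i<m. card {R \<in> objects D. grade D R i = \<tau>}) \<le> (\<Sum>i<m. 1)"
    by (intro sum_mono) auto
  then have "card T \<le> m"
    using card_UN_le[of "{..<m}" "\<lambda>i. {R \<in> objects D. grade D R i = \<tau>}"] by (simp add: T_def)
  moreover have "card C \<le> card Y + card P + card T"
    unfolding C_def by (meson add_le_mono1 card_Un_le order_trans)
  ultimately have "card C \<le> k + random_count HA + m"
    using random_objects(2)[of HA] Y(2) by (simp add: P_def)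

  have late: "Y \<subseteq> seen H \<and> (M_bound m k H < \<tau> \<longrightarrow> (\<exists>R'\<in>candidates m k H. \<tau> \<le> B_bound m H R'))
      \<and> (\<forall>R\<in>candidates m k H. M_bound m k H < B_bound m H R)"
    if H: "CA_hist H" "round_complete m H" "d \<le> depth m H" and no_\<tau>: "\<And>i. i < m \<Longrightarrow> bottom H i \<noteq> \<tau>" for H
  proof -
    have hist: "history m D H" using CA_history_history[OF H(1)] .
    have seen: "Y \<subseteq> seen H"
    proof
      fix R assume R: "R \<in> Y"
      show "R \<in> seen H"
      proof (rule ccontr)
        \<comment> \<open>Then its grade in list \<open>i\<^sub>0\<close> is at most the bottom
          value of CA, hence at most that of the competitor and at most \<open>\<tau>\<close>. As
          the grade is also at least \<open>\<tau>\<close>, the bottom value of CA would be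
          \<open>\<tau>\<close>.\<close>
        assume "R \<notin> seen H"
        then have "R \<notin> set (take (sorted_pos H i\<^sub>0) (sorted_list D i\<^sub>0))"
          using fields_iff[OF hist, of i\<^sub>0 R] bottom_HA(1) R Y(1) by (auto simp: seen_def)
        then have "grade D R i\<^sub>0 \<le> bottom H i\<^sub>0"
          using grade_less_bottom(1)[OF hist bottom_HA(1)] R Y(1) by blast
        moreover have "\<tau> \<le> grade D R i\<^sub>0"
          using Y(3)[OF R] overall_le[OF bottom_HA(1), of R] by simp
        moreover have "bottom H i\<^sub>0 \<le> bottom HA i\<^sub>0"
          using bottom_antimono[OF HA hist bottom_HA(1)] pos[OF bottom_HA(1)] H(2,3)
            CA_hist_pos_le_N[OF H(1) bottom_HA(1)] bottom_HA(1) by (simp add: round_complete_def)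
        ultimately show False using no_\<tau>[OF bottom_HA(1)] bottom_HA(2) by simp
      qed
    qed
    then have card: "k \<le> card (seen H)"
      using card_mono[OF finite_seen[OF hist] seen] Y(2) by simp
    then have viable: "viable m k H R \<longleftrightarrow> M_bound m k H < B_bound m H R" for R
      by (auto simp: viable_def)
    have "\<exists>R'\<in>candidates m k H. \<tau> \<le> B_bound m H R'" if M: "M_bound m k H < \<tau>"
    proof -
      obtain T where "is_T m k H T" using ex_is_T[OF finite_seen[OF hist] card] by blast
      note M_ge = M_bound_ge[OF this k_pos finite_seen[OF hist] seen]
      \<comment> \<open>If \<open>W\<close> were at least \<open>\<tau>\<close> on all
        \<open>k\<close> objects of \<open>Y\<close>, so would be \<open>M_bound\<close>. An object
        with \<open>W\<close> below \<open>\<tau>\<close> cannot be fully known.\<close>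
      obtain R' where R': "R' \<in> Y" "W_bound m H R' < \<tau>"
        using M_ge[of \<tau>] Y(2) M by (meson linorder_not_less order_refl)
      then have "\<not> {..<m} \<subseteq> fields H R'"
        using bounds_known(1)[OF hist, of R'] Y(3) by force
      moreover have "\<tau> \<le> B_bound m H R'"
        using overall_le_B_bound[OF hist, of R'] Y(1,3) R'(1) by force
      ultimately show ?thesis
        using R'(1) seen M by (auto simp: candidates_def viable)
    qed
    then show ?thesis using seen by (auto simp: candidates_def viable)
  qed

  have "depth m H div h \<le> d div h + m + card C + 1"
    using H
  proof (rule phases_le[where \<tau> = \<tau>])
    show "finite C" using fin by (simp add: C_def)
  next
    fix H R
    assume H: "CA_hist H" "round_complete m H" "d \<le> depth m H" "\<And>i. i < m \<Longrightarrow> bottom H i \<noteq> \<tau>"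
      and R: "R \<in> best_candidates m k H"
    have hist: "history m D H" using CA_history_history[OF H(1)] .
    note late = late[OF H]
    have "R \<in> objects D" using best_candidates_objects[OF H(1) R] .
    show "R \<in> C"
    proof (rule ccontr)
      assume "R \<notin> C"
      then have not: "R \<notin> Y" "R \<notin> P" "\<And>i. i < m \<Longrightarrow> grade D R i \<noteq> \<tau>"
        using \<open>R \<in> objects D\<close> by (auto simp: C_def T_def)
      \<comment> \<open>The competitor made no random access to \<open>R\<close>, so all it knows of
        \<open>R\<close> comes from sorted accesses, which CA has made too.\<close>
      have "B_bound m H R \<le> B_bound m HA R"
        unfolding B_bound_def
      proof (rule agg_min_mono[OF m_pos])
        fix i assume i: "i < m"
        have le: "sorted_pos HA i \<le> sorted_pos H i"
          using pos[OF i] H(2,3) i by (simp add: round_complete_def)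
        have bottom: "bottom H i \<le> bottom HA i"
          using bottom_antimono[OF HA hist i le CA_hist_pos_le_N[OF H(1) i]] .
        show "(if i \<in> fields H R then field_value H R i else bottom H i)
          \<le> (if i \<in> fields HA R then field_value HA R i else bottom HA i)"
        proof (cases "i \<in> fields HA R")
          case True
          then have "i \<in> fields H R"
            using fields_iff[OF HA, of i R] fields_iff[OF hist, of i R] not(2)
              set_take_subset_set_take[OF le, of "sorted_list D i"]
            by (auto simp: P_def)
          then show ?thesis
            using True field_value[OF HA True] field_value[OF hist] by simp
        next
          case False
          then have "grade D R i \<le> bottom HA i"
            using fields_iff[OF HA, of i R] grade_less_bottom(1)[OF HA i] \<open>R \<in> objects D\<close> i by blast
          then show ?thesis using False bottom field_value[OF hist, of i R] by simp
        qed
      qed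
      also have "\<dots> \<le> \<tau>" using B_HA \<open>R \<in> objects D\<close> not(1) by blast
      finally have le: "B_bound m H R \<le> \<tau>" .
      then have "M_bound m k H < \<tau>"
        using late R by (fastforce simp: best_candidates_def)
      then obtain R' where "R' \<in> candidates m k H" "\<tau> \<le> B_bound m H R'" using late by blast
      then have "B_bound m H R = \<tau>"
        using R le by (fastforce simp: best_candidates_def)
      moreover obtain i where "i < m"
          "B_bound m H R = (if i \<in> fields H R then field_value H R i else bottom H i)"
        using agg_min_attained[OF m_pos] unfolding B_bound_def by blast
      ultimately show False
        using H(4) not(3) field_value[OF hist, of i R] by (auto split: if_splits)
    qed
  next
    fix H
    assume H: "CA_hist H" "round_complete m H" "d \<le> depth m H" "\<And>i. i < m \<Longrightarrow> bottom H i \<noteq> \<tau>"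
      and none: "best_candidates m k H = {}"
    have hist: "history m D H" using CA_history_history[OF H(1)] .
    note late = late[OF H]
    have fin_seen: "finite (seen H)" using finite_seen[OF hist] .
    have no_cand: "candidates m k H = {}"
    proof (rule ccontr)
      assume "candidates m k H \<noteq> {}"
      moreover have "finite (candidates m k H)"
        using fin_seen by (simp add: candidates_def)
      ultimately show False
        using ex_lex_max[of "candidates m k H" "B_bound m H" "B_bound m H"] none
        by (auto simp: best_candidates_def dest: less_imp_le)
    qed
    have card: "k \<le> card (seen H)"
      using card_mono[OF fin_seen, of Y] late Y(2) by simp
    obtain T where T: "is_T m k H T" using ex_is_T[OF fin_seen card] by blast
    have "B_bound m H R \<le> M_bound m k H" if "R \<notin> T" for R
    proof (cases "R \<in> seen H")
      case True
      show ?thesis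
      proof (rule ccontr)
        assume above: "\<not> B_bound m H R \<le> M_bound m k H"
        then have "{..<m} \<subseteq> fields H R"
          using no_cand True by (auto simp: candidates_def viable_def)
        then have "B_bound m H R = W_bound m H R" using bounds_known[OF hist] by simp
        then show False
          using W_bound_le_M[OF T k_pos fin_seen, of R] True that above by simp
      qed
    next
      case False
      have "B_bound m H R \<le> bottom H i\<^sub>0"
        using B_bound_unseen[OF False] agg_min_le[OF bottom_HA(1)] by simp
      also have "\<dots> \<le> bottom HA i\<^sub>0"
        using bottom_antimono[OF HA hist bottom_HA(1)] pos[OF bottom_HA(1)] H(2,3)
          CA_hist_pos_le_N[OF H(1) bottom_HA(1)] bottom_HA(1) by (simp add: round_complete_def)
      finally have "B_bound m H R \<le> \<tau>" using bottom_HA(2) by simp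
      \<comment> \<open>By \<open>late\<close>, the absence of candidates means that
        \<open>M_bound\<close> is at least \<open>\<tau>\<close>.\<close>
      then show ?thesis using late no_cand by force
    qed
    then show "halting_moves m k H \<noteq> {}"
      using T card by (auto simp: halting_moves_def)
  qed
  then show ?thesis using \<open>card C \<le> k + random_count HA + m\<close> by linarith
qed

section \<open>Termination, correctness and cost of CA\<close>

lemma CA_moves_nonempty: "CA_moves m k h H \<noteq> {}"
proof -
  have "next_sorted m H \<noteq> {}"
    using depth_attained[OF m_pos, of H] by (auto simp: next_sorted_def)
  then show ?thesis by (simp add: CA_moves_def)
qed

lemma CA_in_moves: "tie_breaker tb \<Longrightarrow> CA m k h tb H \<in> CA_moves m k h H"
  using CA_moves_nonempty[of H] by (simp add: CA_def tie_breaker_def)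

lemma CA_hist_run:
  assumes "tie_breaker tb" "\<And>n' Y. n' < n \<Longrightarrow> CA m k h tb (run m (CA m k h tb) D n') \<noteq> Halt Y"
  shows "CA_hist (run m (CA m k h tb) D n)"
  using assms(2)
proof (induction n)
  case 0
  show ?case by (simp add: CA_history.Nil)
next
  case (Suc n)
  then show ?case
    using CA_history.step[OF _ CA_in_moves[OF assms(1)]] by simp
qed

lemma CA_halt:
  assumes "Halt Y \<in> CA_moves m k h H"
  shows "round_complete m H" "Halt Y \<in> halting_moves m k H"
  using assms by (auto simp: CA_moves_def next_sorted_def pending_def split: if_splits)

text \<open>Every move other than halting adds an event, while the length of a history of CA is
  bounded.\<close>

lemma CA_halts:
  assumes tb: "tie_breaker tb"
  shows "halts m (CA m k h tb) D"
proof (rule ccontr)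
  let ?A = "CA m k h tb"
  assume "\<not> halts m ?A D"
  then have never: "?A (run m ?A D n) \<noteq> Halt Y" for n Y by (auto simp: halts_def)
  have len: "length (run m ?A D n) = n" for n
  proof (induction n)
    case (Suc n)
    then show ?case using never[of n] by (cases "?A (run m ?A D n)") auto
  qed simp
  have bound: "length H \<le> m * N + m * N" if H: "CA_hist H" for H
  proof -
    have "length H = length (filter is_sorted_ev H) + random_count H"
      unfolding random_count_def by (rule sum_length_filter_compl[symmetric])
    moreover have "length (filter is_sorted_ev H) \<le> m * N"
      using sum_bounded_above[of "{..<m}" "sorted_pos H" N] CA_hist_pos_le_N[OF H]
      by (simp add: sorted_count[OF H])
    moreover have "random_count H \<le> m * N"
    proof -
      have "depth m H div h \<le> N"
        using CA_hist_depth_le[OF H] div_le_dividend order_trans by blast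
      then show ?thesis using random_count_le[OF H] by (meson mult_le_mono2 order_trans)
    qed
    ultimately show ?thesis by simp
  qed
  have "CA_hist (run m ?A D (Suc (m * N + m * N)))"
    using CA_hist_run[OF tb] never by blast
  from bound[OF this] show False by (simp only: len)
qed

lemma CA_final:
  assumes tb: "tie_breaker tb"
  defines "H \<equiv> final_history m (CA m k h tb) D"
  shows "CA_hist H" "round_complete m H" "CA m k h tb H = Halt Y \<Longrightarrow> is_top_answer m k D Y"
proof -
  let ?A = "CA m k h tb"
  obtain n Y' where n: "?A (run m ?A D n) = Halt Y'" "H = run m ?A D n"
    "\<And>n' Y''. n' < n \<Longrightarrow> ?A (run m ?A D n') \<noteq> Halt Y''"
    using halting_run[OF CA_halts[OF tb]] unfolding H_def by metis
  show H: "CA_hist H" using CA_hist_run[OF tb n(3)] n(2) by simp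
  have move: "?A H = Halt Y \<Longrightarrow> Halt Y \<in> CA_moves m k h H" for Y
    using CA_in_moves[OF tb, of H] by simp
  show "round_complete m H" using CA_halt(1)[OF move] n(1,2) by simp
  show "?A H = Halt Y \<Longrightarrow> is_top_answer m k D Y"
    using halting_moves_correct[OF CA_history_history[OF H] CA_halt(2)[OF move]] .
qed

lemma CA_cost_le:
  assumes "tie_breaker tb" "0 \<le> cR"
  defines "H \<equiv> final_history m (CA m k h tb) D"
  shows "middleware_cost m cS cR (CA m k h tb) D \<le>
    real (m * depth m H) * cS + real (m * (depth m H div h)) * cR"
proof -
  note H = CA_final(1,2)[OF assms(1), folded H_def]
  have "length (filter is_sorted_ev H) = m * depth m H"
    using H(2) by (simp add: sorted_count[OF H(1)] round_complete_def)
  moreover have "real (random_count H) * cR \<le> real (m * (depth m H div h)) * cR"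
    using random_count_le[OF H(1)] assms(2) by (intro mult_right_mono of_nat_mono)
  ultimately show ?thesis
    by (simp add: middleware_cost_def H_def[symmetric] Let_def random_count_def)
qed

text \<open>Infinitely many names provide an object that is absent and never accessed. Its
  \<open>B\<close> value is the minimum of the bottom values, so the adversary argument yields a
  list whose bottom value is at most \<open>\<tau>\<close>.\<close>

lemma CA_phases_le_competitor:
  assumes inf: "infinite (UNIV :: 'a set)"
    and A: "A \<in> correct_algorithms m k (distinct_databases m k)"
    and HA: "HA = final_history m A D" and pos: "\<And>i. i < m \<Longrightarrow> sorted_pos HA i \<le> d" and d: "d < N"
    and H: "CA_hist H"
  shows "depth m H div h \<le> d div h + random_count HA + 2 * m + k + 1"
proof -
  have hist: "history m D HA" using HA history_run by (simp add: final_history_def)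
  obtain Y where Y: "A HA = Halt Y"
    using A database HA by (auto simp: correct_algorithms_def elim!: halting_run[of m A D])
  then have top: "is_top_answer m k D Y"
    using A database HA by (auto simp: correct_algorithms_def)
  define \<tau> where "\<tau> = Min (overall m D ` Y)"
  have Y': "Y \<subseteq> objects D" "card Y = k" using top by (auto simp: is_top_answer_def)
  then have "finite Y" "Y \<noteq> {}" using k_pos finite_objects finite_subset by fastforce+
  then have \<tau>: "\<tau> \<le> overall m D R" if "R \<in> Y" for R using that by (simp add: \<tau>_def)
  have "\<tau> \<in> overall m D ` Y"
    unfolding \<tau>_def using \<open>finite Y\<close> \<open>Y \<noteq> {}\<close> by (intro Min_in) auto
  then obtain R\<^sub>0 where R\<^sub>0: "R\<^sub>0 \<in> Y" "\<tau> = overall m D R\<^sub>0" by blast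
  have pos_le: "sorted_pos HA i \<le> N" if "i < m" for i using pos[OF that] d by simp
  have B_le: "B_bound m HA Z \<le> \<tau>"
    if "Z \<notin> Y" "Z \<in> objects D \<or> (\<forall>i v. RandomEv Z i v \<notin> set HA) \<and> (\<forall>i<m. 0 < bottom HA i)" for Z
    using correct_output_bounds[OF A HA Y pos_le that R\<^sub>0(1)]
      W_bound_le_overall[OF hist, of R\<^sub>0] R\<^sub>0 Y'(1) by auto
  \<comment> \<open>As \<open>d < N\<close>, the last entry of each list is unread and lies strictly
    below the bottom value once reading has begun.\<close>
  have bottom: "0 < bottom HA i" if "i < m" for i
  proof -
    let ?R = "sorted_list D i ! (N - 1)"
    have "0 < sorted_pos HA i \<Longrightarrow> 0 \<le> grade D ?R i \<and> grade D ?R i < bottom HA i"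
      using bottom_eq[OF hist that pos_le[OF that]] grade_strict[OF that, of "sorted_pos HA i - 1" "N - 1"]
        grade_nonneg[OF nth_list[OF that] that, of "N - 1"] pos[OF that] d by auto
    then show ?thesis using bottom_eq[OF hist that pos_le[OF that]] by fastforce
  qed
  define X where "X = objects D \<union> {R. \<exists>i v. RandomEv R i v \<in> set HA}"
  have "finite X" using finite_objects random_objects(1) by (simp add: X_def)
  then obtain Z where Z: "Z \<notin> X" using inf ex_new_if_finite by blast
  then have "B_bound m HA Z \<le> \<tau>" using Y'(1) bottom by (intro B_le) (auto simp: X_def)
  moreover have "Z \<notin> seen HA" using Z seen_subset[OF hist] by (auto simp: X_def)
  ultimately have "agg_min m (bottom HA) \<le> \<tau>" using B_bound_unseen by metis
  then obtain i\<^sub>0 where "i\<^sub>0 < m" "bottom HA i\<^sub>0 \<le> \<tau>"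
    using agg_min_attained[OF m_pos, of "bottom HA"] by auto
  then show ?thesis
    using phases_le_competitor[OF hist pos Y' \<tau> _ _ _ H] B_le by blast
qed

end

section \<open>Constants of the cost comparison\<close>

lemma cost_arithmetic:
  fixes cS cR :: real
  assumes "0 < cS" "cS \<le> cR"
  defines "h \<equiv> nat \<lfloor>cR / cS\<rfloor>"
  shows "0 < h" "real h * cS \<le> cR" "real (j div h) * cR \<le> 2 * real j * cS"
proof -
  have "1 \<le> cR / cS" using assms by simp
  then have "1 \<le> \<lfloor>cR / cS\<rfloor>" by simp
  then show "0 < h" by (simp add: h_def)
  have h: "real h = of_int \<lfloor>cR / cS\<rfloor>" using \<open>1 \<le> \<lfloor>cR / cS\<rfloor>\<close> by (simp add: h_def)
  then have "real h \<le> cR / cS" by simp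
  then show "real h * cS \<le> cR" using assms(1) by (simp add: field_simps)
  \<comment> \<open>Since \<open>h\<close> is at least 1, rounding down loses at most a factor
    2.\<close>
  have "cR / cS < real h + 1" using h by linarith
  also have "\<dots> \<le> 2 * real h" using \<open>0 < h\<close> by simp
  finally have "cR \<le> 2 * real h * cS" using assms(1) by (simp add: field_simps)
  then have "real (j div h) * cR \<le> real (j div h) * (2 * real h * cS)"
    by (intro mult_left_mono) auto
  also have "\<dots> = 2 * real (j div h * h) * cS" by simp
  also have "\<dots> \<le> 2 * real j * cS"
    using assms(1) div_times_less_eq_dividend[of j h]
    by (intro mult_right_mono mult_left_mono) (auto simp del: of_nat_mult)
  finally show "real (j div h) * cR \<le> 2 * real j * cS" .
qed

theorem theorem8p10:
  fixes m k :: nat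
  assumes "0 < m" and "0 < k"
  shows "\<exists>c::real. \<forall>cS cR :: real. 0 < cS \<longrightarrow> cS \<le> cR \<longrightarrow>
    (\<forall>tb :: 'a event list \<Rightarrow> 'a move set \<Rightarrow> 'a move. tie_breaker tb \<longrightarrow>
      instance_optimal (middleware_cost m cS cR)
        (CA m k (nat \<lfloor>cR / cS\<rfloor>) tb)
        (correct_algorithms m k (distinct_databases m k))
        (distinct_databases m k)
        c)"
\<comment> \<open>Down to the reading depth of the competitor, CA spends at most
  \<open>m * cS\<close> per round on sorted and, averaged over the rounds, \<open>2 * m * cS\<close>
  on random accesses.\<close>
proof (intro exI[of _ "3 * real m"] allI impI)
  fix cS cR :: real and tb :: "'a event list \<Rightarrow> 'a move set \<Rightarrow> 'a move"
  assume c: "0 < cS" "cS \<le> cR" and tb: "tie_breaker tb"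
  let ?h = "nat \<lfloor>cR / cS\<rfloor>"
  let ?CA = "CA m k ?h tb"
  let ?DB = "distinct_databases m k :: 'a database set"
  let ?cost = "middleware_cost m cS cR :: 'a algorithm \<Rightarrow> 'a database \<Rightarrow> real"
  note arith = cost_arithmetic[OF c]
  have loc: "CA_database m k D ?h" if "D \<in> ?DB" for D
    using that assms arith(1) by unfold_locales
  have correct: "?CA \<in> correct_algorithms m k ?DB"
    using CA_database.CA_halts[OF loc tb] CA_database.CA_final(3)[OF loc tb]
    by (auto simp: correct_algorithms_def)
  \<comment> \<open>What remains of \<open>(2 * real q + 1) * cR\<close> below after
    \<open>2 * (real r * cR)\<close> is split off.\<close>
  define V where "V = (4 * real m + 2 * real k + 3) * cR"
  \<comment> \<open>\<open>card UNIV\<close> is 0 for an infinite type; its term serves the finite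
    case.\<close>
  define c' where "c' = real m * (3 * (real (card (UNIV :: 'a set)) * cS) + V)"
  have "?cost ?CA D \<le> 3 * real m * ?cost A D + c'"
    if A: "A \<in> correct_algorithms m k ?DB" and D: "D \<in> ?DB" for A D
  proof -
    interpret CA_database m k D ?h using loc[OF D] .
    define HA where "HA = final_history m A D"
    define j where "j = depth m (final_history m ?CA D)"
    define s where "s = length (filter is_sorted_ev HA)"
    define r where "r = random_count HA"
    have hist: "CA_hist (final_history m ?CA D)" using CA_final(1)[OF tb] .
    have "0 \<le> V" using c by (simp add: V_def)
    then have nonneg: "0 \<le> real s * cS" "0 \<le> real r * cR" "0 \<le> real (card (UNIV :: 'a set)) * cS"
      "0 \<le> V"
      using c by auto
    have cost_A: "?cost A D = real s * cS + real r * cR"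
      by (simp add: middleware_cost_def HA_def s_def r_def random_count_def Let_def)
    have cost_CA: "?cost ?CA D \<le> real m * (real j * cS + real (j div ?h) * cR)"
      using CA_cost_le[OF tb, of cR cS] c by (simp add: j_def algebra_simps)
    have shallow: "real j * cS + real (j div ?h) * cR \<le> 3 * (real x * cS)" if "j \<le> x" for x
    proof -
      have "real j * cS + real (j div ?h) * cR \<le> 3 * (real j * cS)"
        using arith(3)[of j] by (simp add: algebra_simps)
      also have "\<dots> \<le> 3 * (real x * cS)" using that c by (simp add: mult_right_mono)
      finally show ?thesis .
    qed
    have "real j * cS + real (j div ?h) * cR \<le> 3 * (real s * cS + real r * cR)
        + (3 * (real (card (UNIV :: 'a set)) * cS) + V)"
    proof (cases "finite (UNIV :: 'a set)")
      case True
      have "j \<le> N" using CA_hist_depth_le[OF hist] by (simp add: j_def)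
      also have "N \<le> card (UNIV :: 'a set)" using True by (intro card_mono) auto
      finally show ?thesis by (rule order_trans[OF shallow]) (use nonneg in argo)
    next
      case inf: False
      show ?thesis
      proof (cases "j \<le> s")
        case True
        then show ?thesis using shallow[OF True] nonneg by argo
      next
        case False
        \<comment> \<open>The total \<open>s\<close> bounds the position of the competitor in each
          list, so it takes the role of \<open>d\<close>, and no list was exhausted.\<close>
        then have "s < N" using CA_hist_depth_le[OF hist] by (simp add: j_def)
        define q where "q = r + 2 * m + k + 1"
        have "j div ?h \<le> s div ?h + q"
          using CA_phases_le_competitor[OF inf A HA_def _ \<open>s < N\<close> hist] sorted_pos_le_sorted_count[of HA]
          by (simp add: j_def q_def r_def s_def)
        then have phases: "real (j div ?h) * cR \<le> real (s div ?h) * cR + real q * cR"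
          using c by (simp flip: of_nat_add distrib_right)
        \<comment> \<open>Fewer than \<open>h\<close> rounds follow the last multiple of
          \<open>h\<close>.\<close>
        have "j \<le> ?h * (j div ?h) + ?h"
          using mult_div_mod_eq[of ?h j] mod_less_divisor[OF arith(1), of j] by linarith
        also have "\<dots> \<le> ?h * (s div ?h + q) + ?h"
          using \<open>j div ?h \<le> _\<close> by simp
        also have "\<dots> \<le> s + ?h * (q + 1)"
          using times_div_less_eq_dividend[of ?h s] by (simp add: algebra_simps)
        finally have "real j \<le> real s + real ?h * (real q + 1)"
          by (metis (mono_tags) of_nat_1 of_nat_add of_nat_le_iff of_nat_mult)
        then have "real j * cS \<le> (real s + real ?h * (real q + 1)) * cS"
          using c by (intro mult_right_mono) auto
        also have "\<dots> = real s * cS + (real q + 1) * (real ?h * cS)" by (simp add: algebra_simps)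
        also have "\<dots> \<le> real s * cS + (real q + 1) * cR"
          using arith(2) by (intro add_left_mono mult_left_mono) auto
        finally have "real j * cS + real (j div ?h) * cR \<le> 3 * (real s * cS) + (2 * real q + 1) * cR"
          using phases arith(3)[of s] by (simp add: algebra_simps)
        also have "(2 * real q + 1) * cR = 2 * (real r * cR) + V"
          by (simp add: q_def V_def algebra_simps)
        finally show ?thesis
          using nonneg by argo
      qed
    qed
    then have "real m * (real j * cS + real (j div ?h) * cR) \<le> real m * (3 * (real s * cS + real r * cR)
        + (3 * (real (card (UNIV :: 'a set)) * cS) + V))"
      by (rule mult_left_mono) simp
    then show ?thesis
      using cost_CA by (simp add: cost_A c'_def algebra_simps)
  qed
  then show "instance_optimal ?cost ?CA (correct_algorithms m k ?DB) ?DB (3 * real m)"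
    using correct by (auto simp: instance_optimal_def)
qed

end
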